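(* There are absolute constants $c_1,c_2>0$ such that for every integer $n'$ there exist an integer $n\ge n'$ and a set $X$ of $n$ points in the plane that is a permutation, such that $\mathrm{opt}(X)\ge c_1\, n\log\log n$ but $\mathrm{WB}(X)\le c_2\, n\log\log\log n$. In other words, for every ordering $\sigma$ of $\mathcal L(X)$ (equivalently every partitioning tree), $\mathrm{opt}(X)/\mathrm{WB}_\sigma(X)\ge \Omega\!\left(\frac{\log\log n}{\log\log\log n}\right)$.
   Context: Points have integer coordinates. Two points $p,q$ are collinear if $p.x=q.x$ or $p.y=q.y$; otherwise $\square_{p,q}$ is the smallest closed axis-parallel rectangle containing $p$ and $q$. A non-collinear pair $(p,q)$ is satisfied in a point set $S$ if some point $r\in S\setminus\{p,q\}$ lies in $\square_{p,q}$; $S$ is satisfied if every non-collinear pair of its points is satisfied in $S$. A row (column) is a horizontal (vertical) line; it is active for $X$ if it contains a point of $X$. $X$ is a semi-permutation if every active row contains exactly one point of $X$, and a permutation if moreover every active column contains exactly one point of $X$. For a finite semi-permutation $X$, $\mathrm{opt}(X)$ is the minimum of $|Y|$ over all point sets $Y$ with $X\cup Y$ satisfied (the Min-Sat problem; this equals, up to a constant factor, the optimal cost of a binary search tree execution on the access sequence encoded by $X$, where a point $(x,t)$ means key $x$ is accessed at time $t$). Strong Wilber bound: let $B$ be the bounding box of $X$ and $\mathcal L(X)$ the set of vertical lines with half-integral $x$-coordinate strictly between the minimum and maximum $x$-coordinates of $X$. For an ordering $\sigma$ of $\mathcal L(X)$, start with the partition $\{B\}$ and process the lines in order; each line $L$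 splits the unique current vertical strip $S$ containing it into two strips, and is charged $\mathrm{cost}(L)=$ the number of indices $j$ such that $q_j,q_{j+1}$ lie on opposite sides of $L$, where $q_1,\dots,q_z$ are the points of $X\cap S$ in increasing order of $y$-coordinate. $\mathrm{WB}_\sigma(X)=\sum_L \mathrm{cost}(L)$ and $\mathrm{WB}(X)=\max_\sigma \mathrm{WB}_\sigma(X)$. *)

theory Defs
  imports Complex_Main "HOL-Library.Product_Lexorder"
begin

type_synonym point = "int \<times> int"   \<comment> \<open>(x, y): x = key, y = time\<close>

definition collinear :: "point \<Rightarrow> point \<Rightarrow> bool" where
  "collinear p q \<longleftrightarrow> fst p = fst q \<or> snd p = snd q"

definition in_box :: "point \<Rightarrow> point \<Rightarrow> point \<Rightarrow> bool" where
  "in_box p q r \<longleftrightarrow>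
     min (fst p) (fst q) \<le> fst r \<and> fst r \<le> max (fst p) (fst q) \<and>
     min (snd p) (snd q) \<le> snd r \<and> snd r \<le> max (snd p) (snd q)"

definition pair_satisfied :: "point set \<Rightarrow> point \<Rightarrow> point \<Rightarrow> bool" where
  "pair_satisfied S p q \<longleftrightarrow> (\<exists>r \<in> S - {p, q}. in_box p q r)"

definition satisfied :: "point set \<Rightarrow> bool" where
  "satisfied S \<longleftrightarrow> (\<forall>p\<in>S. \<forall>q\<in>S. \<not> collinear p q \<longrightarrow> pair_satisfied S p q)"

definition semi_permutation :: "point set \<Rightarrow> bool" where
  "semi_permutation X \<longleftrightarrow> (\<forall>p\<in>X. \<forall>q\<in>X. snd p = snd q \<longrightarrow> p = q)"

definition permutation :: "point set \<Rightarrow> bool" where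
  "permutation X \<longleftrightarrow> semi_permutation X \<and> (\<forall>p\<in>X. \<forall>q\<in>X. fst p = fst q \<longrightarrow> p = q)"

definition opt :: "point set \<Rightarrow> nat" where
  "opt X = Inf {card Y | Y. finite Y \<and> satisfied (X \<union> Y)}"

text \<open>The vertical line with x-coordinate k + 1/2 is encoded by the integer k.
  The lines of L(X) are those strictly between min and max x-coordinate of X.\<close>
definition lines :: "point set \<Rightarrow> int set" where
  "lines X = {k. Min (fst ` X) \<le> k \<and> k < Max (fst ` X)}"

text \<open>Current strip containing line k after the lines in E have been processed.\<close>
definition strip_points :: "point set \<Rightarrow> int set \<Rightarrow> int \<Rightarrow> point set" where
  "strip_points X E k =
     {p \<in> X. \<forall>l\<in>E. (l < k \<longrightarrow> l < fst p) \<and> (k < l \<longrightarrow> fst p \<le> l)}"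

definition crossings :: "point set \<Rightarrow> int \<Rightarrow> nat" where
  "crossings S k =
     (let qs = sort_key snd (sorted_list_of_set S) in
      card {j. j + 1 < length qs \<and> ((fst (qs ! j) \<le> k) \<noteq> (fst (qs ! (j + 1)) \<le> k))})"

definition WB_sigma :: "point set \<Rightarrow> int list \<Rightarrow> nat" where
  "WB_sigma X \<sigma> =
     (\<Sum>i<length \<sigma>. crossings (strip_points X (set (take i \<sigma>)) (\<sigma> ! i)) (\<sigma> ! i))"

definition orderings :: "point set \<Rightarrow> int list set" where
  "orderings X = {\<sigma>. distinct \<sigma> \<and> set \<sigma> = lines X}"

definition WB :: "point set \<Rightarrow> nat" where
  "WB X = Max (WB_sigma X ` orderings X)"

end

theory Submission
  imports Defs
begin

text \<open>
  Let \<open>h = 2^i\<close> and \<open>N = 2^h\<close>. Block \<open>s < N\<close> consists of \<open>h\<close> points with keys \<open>h s + h 2^j + j\<close>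
  for \<open>j < h\<close>, accessed in bit-reversal order of \<open>j\<close> during the times \<open>h s, \<dots>, h s + h - 1\<close>. Each
  block alone forces \<open>h i / 2\<close> additional points, so \<open>opt\<close> is at least \<open>n i / 2\<close> with \<open>n = N h\<close> and
  \<open>i\<close> about \<open>log log n\<close>.

  The bound on \<open>WB\<close> is even linear in \<open>n\<close>. Consider a line cutting a strip of \<open>w\<close> keys so that
  the narrower side has \<open>m\<close> keys. Since a block is a shift of the previous one, nearly all
  crossings come from blocks that meet both sides, and as keys are exponentially spaced
  the cost is \<open>O((m / h) log (w / m) + min m h)\<close>, or \<open>O(1)\<close> if \<open>w \<le> h\<close>. By the chain rule for the
  entropy, \<open>m log (w / m)\<close> sums up to \<open>O(n log n) = O(n h)\<close> over any partitioning tree, and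
  \<open>min m h\<close> sums up to \<open>O(n)\<close> over the strips with \<open>w > h\<close>.
\<close>

section \<open>Rows meeting both sides of a line\<close>

text \<open>A witness for a pair lies in the box of the pair, so a box-closed region keeps every
  witness it needs.\<close>

lemma satisfied_Int_box_closed:
  assumes S: "satisfied S"
    and B: "\<And>p q r. p \<in> B \<Longrightarrow> q \<in> B \<Longrightarrow> in_box p q r \<Longrightarrow> r \<in> B"
  shows "satisfied (S \<inter> B)"
  unfolding satisfied_def pair_satisfied_def
proof (intro ballI impI)
  fix p q assume p: "p \<in> S \<inter> B" and q: "q \<in> S \<inter> B" and "\<not> collinear p q"
  then obtain r where r: "r \<in> S - {p, q}" "in_box p q r"
    using S unfolding satisfied_def pair_satisfied_def by blast
  then show "\<exists>r\<in>S \<inter> B - {p, q}. in_box p q r"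
    using B[of p q r] p q by blast
qed

lemma satisfied_left: "satisfied S \<Longrightarrow> satisfied (S \<inter> {p. fst p \<le> k})"
  by (rule satisfied_Int_box_closed) (auto simp: in_box_def)

lemma satisfied_right: "satisfied S \<Longrightarrow> satisfied (S \<inter> {p. k < fst p})"
  by (rule satisfied_Int_box_closed) (auto simp: in_box_def)

lemma satisfied_band: "satisfied S \<Longrightarrow> satisfied (S \<inter> {p. a \<le> snd p \<and> snd p < b})"
  by (rule satisfied_Int_box_closed) (auto simp: in_box_def)

text \<open>A closest pair of points on opposite sides of the line must share a row: any third
  point of its box could replace one of the two.\<close>

lemma row_meeting_both_sides:
  assumes S: "satisfied S"
    and "p \<in> S" "q \<in> S" "fst p \<le> k" "k < fst q"
    and "snd p \<in> {a..b}" "snd q \<in> {a..b}"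
  shows "\<exists>y\<in>{a..b}. y \<in> snd ` (S \<inter> {p. fst p \<le> k}) \<and> y \<in> snd ` (S \<inter> {p. k < fst p})"
  using assms(2-)
proof (induction "nat (\<bar>fst p - fst q\<bar> + \<bar>snd p - snd q\<bar>)" arbitrary: p q rule: less_induct)
  case less
  show ?case
  proof (cases "snd p = snd q")
    case True
    have "snd p \<in> snd ` (S \<inter> {p. fst p \<le> k})" "snd p \<in> snd ` (S \<inter> {p. k < fst p})"
      using less.prems True by (auto intro: rev_image_eqI[of p] rev_image_eqI[of q])
    with less.prems(5) show ?thesis by blast
  next
    case False
    then have "\<not> collinear p q" using less.prems by (auto simp: collinear_def)
    then obtain r where r: "r \<in> S" "r \<noteq> p" "r \<noteq> q" "in_box p q r"
      using S less.prems unfolding satisfied_def pair_satisfied_def by blast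
    have row: "snd r \<in> {a..b}" using r(4) less.prems by (auto simp: in_box_def min_def max_def split: if_splits)
    have box: "fst p \<le> fst r" "fst r \<le> fst q" "min (snd p) (snd q) \<le> snd r" "snd r \<le> max (snd p) (snd q)"
      using r(4) less.prems by (auto simp: in_box_def)
    have ne: "0 < \<bar>fst p - fst r\<bar> + \<bar>snd p - snd r\<bar>" "0 < \<bar>fst r - fst q\<bar> + \<bar>snd r - snd q\<bar>"
      using r(2,3) by (auto simp: prod_eq_iff)
    \<comment> \<open>As \<open>r\<close> lies in the box of \<open>p\<close> and \<open>q\<close>,
      the L1 distances add up, so replacing either point by \<open>r\<close> strictly shortens the
      pair.\<close>
    have dist_rows: "\<bar>snd p - snd r\<bar> + \<bar>snd r - snd q\<bar> = \<bar>snd p - snd q\<bar>"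
      using box(3,4) by (cases "snd p \<le> snd q") auto
    have dist_cols: "\<bar>fst p - fst r\<bar> + \<bar>fst r - fst q\<bar> = \<bar>fst p - fst q\<bar>"
      using box(1,2) by simp
    have closer: "nat (a + b) < nat (d + e)"
      if "a + a' = d" "b + b' = e" "0 < a' + b'" "0 \<le> a" "0 \<le> b" for a a' b b' d e :: int
      using that by linarith
    show ?thesis
    proof (cases "fst r \<le> k")
      case True
      have "nat (\<bar>fst r - fst q\<bar> + \<bar>snd r - snd q\<bar>) < nat (\<bar>fst p - fst q\<bar> + \<bar>snd p - snd q\<bar>)"
        by (rule closer) (use dist_rows dist_cols ne(1) in \<open>simp_all add: add.commute\<close>)
      from less.hyps[OF this r(1) less.prems(2) True less.prems(4) row less.prems(6)]
      show ?thesis .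
    next
      case False
      have "nat (\<bar>fst p - fst r\<bar> + \<bar>snd p - snd r\<bar>) < nat (\<bar>fst p - fst q\<bar> + \<bar>snd p - snd q\<bar>)"
        by (rule closer) (use dist_rows dist_cols ne(2) in simp_all)
      from less.hyps[OF this less.prems(1) r(1) less.prems(3) _ less.prems(5) row] False
      show ?thesis by simp
    qed
  qed
qed

text \<open>If every row met by \<open>X\<close> contains one point of \<open>X\<close>, then \<open>card Y\<close> is at least the excess
  of \<open>X \<union> Y\<close>.\<close>

definition excess :: "point set \<Rightarrow> int" where
  "excess S = int (card S) - int (card (snd ` S))"

lemma excess_nonneg: "finite S \<Longrightarrow> 0 \<le> excess S"
  by (simp add: excess_def card_image_le)

text \<open>Points are divided between the sides, but a row meeting both sides is counted on each of
  them; inclusion-exclusion gives the correction.\<close>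

lemma excess_split:
  assumes "finite S"
  shows "excess S = excess (S \<inter> {p. fst p \<le> k}) + excess (S \<inter> {p. k < fst p})
    + int (card (snd ` (S \<inter> {p. fst p \<le> k}) \<inter> snd ` (S \<inter> {p. k < fst p})))"
proof -
  let ?L = "S \<inter> {p. fst p \<le> k}" and ?R = "S \<inter> {p. k < fst p}"
  have S: "S = ?L \<union> ?R" by auto
  have "card S = card ?L + card ?R"
    using assms by (subst S, subst card_Un_disjoint) auto
  moreover have "card (snd ` S) + card (snd ` ?L \<inter> snd ` ?R) = card (snd ` ?L) + card (snd ` ?R)"
    using assms by (subst S, subst image_Un, subst card_Un_Int) auto
  ultimately show ?thesis by (simp add: excess_def)
qed

text \<open>The pattern behind the lower bound: one line is crossed inside every pair of positions
  \<open>2 * r\<close>, \<open>2 * r + 1\<close>, and the subsequences on its two sides repeat the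
  pattern. Each of the \<open>i\<close> levels thus has \<open>2 ^ i / 2\<close> pairs.\<close>

primrec interleaved :: "nat \<Rightarrow> (nat \<Rightarrow> int) \<Rightarrow> bool" where
  "interleaved 0 c = True"
| "interleaved (Suc i) c \<longleftrightarrow>
     (\<exists>k. \<forall>r<2^i. c (2 * r) \<le> k \<and> k < c (2 * r + 1)) \<and>
     interleaved i (\<lambda>r. c (2 * r)) \<and> interleaved i (\<lambda>r. c (2 * r + 1))"

text \<open>Each pair \<open>2 * r\<close>, \<open>2 * r + 1\<close> forces a row meeting both sides
  between its two times. These rows count towards the last summand of \<open>excess_split\<close>;
  induction on the even and on the odd positions bounds the other two.\<close>

lemma excess_interleaved:
  assumes "finite S" "satisfied S" "interleaved i c"
    and "\<And>r. r < 2^i \<Longrightarrow> (c r, \<tau> r) \<in> S"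
    and "\<And>r r'. r < r' \<Longrightarrow> r' < 2^i \<Longrightarrow> \<tau> r < \<tau> r'"
  shows "int i * 2^i \<le> 2 * excess S"
  using assms
proof (induction i arbitrary: S c \<tau>)
  case 0
  then show ?case by (simp add: excess_nonneg)
next
  case (Suc i)
  obtain k where k: "\<And>r. r < 2^i \<Longrightarrow> c (2 * r) \<le> k \<and> k < c (2 * r + 1)"
    using Suc.prems(3) by auto
  let ?L = "S \<inter> {p. fst p \<le> k}" and ?R = "S \<inter> {p. k < fst p}"
  let ?B = "snd ` ?L \<inter> snd ` ?R"
  have mem: "(c (2*r), \<tau> (2*r)) \<in> S" "(c (2*r+1), \<tau> (2*r+1)) \<in> S" "\<tau> (2*r) < \<tau> (2*r+1)"
    if "r < 2^i" for r
    using that by (auto intro!: Suc.prems(4,5))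
  have L: "int i * 2^i \<le> 2 * excess ?L"
  proof (rule Suc.IH[where c = "\<lambda>r. c (2*r)" and \<tau> = "\<lambda>r. \<tau> (2*r)"])
    show "(c (2*r), \<tau> (2*r)) \<in> ?L" if "r < 2^i" for r using mem k that by auto
    show "\<tau> (2*r) < \<tau> (2*r')" if "r < r'" "r' < 2^i" for r r' using that by (auto intro!: Suc.prems(5))
  qed (use Suc.prems satisfied_left in auto)
  have R: "int i * 2^i \<le> 2 * excess ?R"
  proof (rule Suc.IH[where c = "\<lambda>r. c (2*r+1)" and \<tau> = "\<lambda>r. \<tau> (2*r+1)"])
    show "(c (2*r+1), \<tau> (2*r+1)) \<in> ?R" if "r < 2^i" for r using mem k that by auto
    show "\<tau> (2*r+1) < \<tau> (2*r'+1)" if "r < r'" "r' < 2^i" for r r' using that by (auto intro!: Suc.prems(5))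
  qed (use Suc.prems satisfied_right in auto)
  have "\<exists>y\<in>{\<tau> (2*r)..\<tau> (2*r+1)}. y \<in> ?B" if "r < 2^i" for r
    using row_meeting_both_sides[OF Suc.prems(2) mem(1,2)[OF that], of k "\<tau> (2*r)" "\<tau> (2*r+1)"]
      k[OF that] mem(3)[OF that] by auto
  then obtain y where y: "\<And>r. r < 2^i \<Longrightarrow> y r \<in> {\<tau> (2*r)..\<tau> (2*r+1)} \<and> y r \<in> ?B"
    by metis
  \<comment> \<open>The time intervals of different pairs are disjoint, so the rows found are
    distinct.\<close>
  have less: "y r < y r'" if "r < r'" "r' < 2^i" for r r'
  proof -
    have "\<tau> (2*r+1) < \<tau> (2*r')" using that by (auto intro!: Suc.prems(5))
    then show ?thesis using y[of r] y[of r'] that by auto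
  qed
  have "inj_on y {..<2^i}"
    by (rule linorder_inj_onI) (use less in force)+
  then have "2^i \<le> card ?B"
    using card_inj_on_le[of y "{..<2^i}" ?B] y Suc.prems(1) by auto
  then have "2^i \<le> int (card ?B)" using of_nat_mono[of "2^i" "card ?B", where 'a = int] by simp
  moreover have "int (Suc i) * 2 ^ Suc i = 2 * (int i * 2^i) + 2 * 2^i"
    by (simp add: algebra_simps)
  ultimately show ?case
    using L R excess_split[OF Suc.prems(1), of k] by linarith
qed

section \<open>The bit-reversal order\<close>

primrec bit_reversal :: "nat \<Rightarrow> nat \<Rightarrow> nat" where
  "bit_reversal 0 r = 0"
| "bit_reversal (Suc i) r = (r mod 2) * 2^i + bit_reversal i (r div 2)"

lemma bit_reversal_less: "bit_reversal i r < 2^i"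
proof (induction i arbitrary: r)
  case (Suc i)
  have "r mod 2 = 0 \<or> r mod 2 = 1" by auto
  then show ?case using Suc[of "r div 2"] by auto
qed simp

lemma bit_reversal_inj: "inj_on (bit_reversal i) {..<2^i}"
proof (induction i)
  case (Suc i)
  show ?case
  proof (rule inj_onI)
    fix r r' assume r: "r \<in> {..<2^Suc i}" "r' \<in> {..<2^Suc i}"
      and eq: "bit_reversal (Suc i) r = bit_reversal (Suc i) r'"
    have "r mod 2 = 0 \<or> r mod 2 = 1" "r' mod 2 = 0 \<or> r' mod 2 = 1" by auto
    then have *: "r mod 2 = r' mod 2" "bit_reversal i (r div 2) = bit_reversal i (r' div 2)"
      using eq bit_reversal_less[of i "r div 2"] bit_reversal_less[of i "r' div 2"] by auto
    moreover have "r div 2 \<in> {..<2^i}" "r' div 2 \<in> {..<2^i}" using r by auto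
    ultimately have "r div 2 = r' div 2" using Suc by (auto dest: inj_onD)
    with * show "r = r'" by (metis div_mult_mod_eq)
  qed
qed (simp add: inj_on_def)

lemma bit_reversal_bij: "bij_betw (bit_reversal i) {..<2^i} {..<2^i}"
  by (simp add: bij_betw_def bit_reversal_inj bit_reversal_less image_subset_iff endo_inj_surj)

text \<open>The lowest bit of \<open>r\<close> becomes the highest bit of its reversal, so even
  positions get keys below \<open>f (2 ^ i)\<close> and odd ones do not. The odd half is the same
  claim for \<open>f\<close> shifted by \<open>2 ^ i\<close>, hence the generalisation over
  \<open>f\<close>.\<close>

lemma interleaved_bit_reversal:
  assumes "\<And>j j'. j < j' \<Longrightarrow> f j < (f j' :: int)"
  shows "interleaved i (\<lambda>r. f (bit_reversal i r))"
  using assms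
proof (induction i arbitrary: f)
  case (Suc i)
  have "f (bit_reversal i r) \<le> f (2^i) - 1" for r
    using Suc.prems[OF bit_reversal_less[of i r]] by simp
  moreover have "f (2^i) - 1 < f (2^i + bit_reversal i r)" for r
    using Suc.prems[of "2^i" "2^i + bit_reversal i r"] by (cases "bit_reversal i r = 0") auto
  moreover have "interleaved i (\<lambda>r. f (bit_reversal i r))"
    "interleaved i (\<lambda>r. f (2^i + bit_reversal i r))"
    using Suc.IH[of f] Suc.IH[of "\<lambda>j. f (2^i + j)"] Suc.prems by auto
  ultimately show ?case
    by (auto intro!: exI[of _ "f (2^i) - 1"])
qed simp

section \<open>Consecutive points on opposite sides of a line\<close>

text \<open>Rises and falls of a Boolean sequence alternate, so their numbers differ by at most one;
  the difference is read off at the two ends.\<close>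

lemma card_steps_alternate:
  "card {j. j < n \<and> \<not> P j \<and> P (Suc j)} + of_bool (P 0)
    = card {j. j < n \<and> P j \<and> \<not> P (Suc j)} + of_bool (P n)"
proof (induction n)
  case (Suc n)
  have split: "{j. j < Suc n \<and> Q j} = (if Q n then insert n {j. j < n \<and> Q j} else {j. j < n \<and> Q j})" for Q
    by (auto simp: less_Suc_eq)
  show ?case
    using Suc by (auto simp: split[of "\<lambda>j. P j \<and> \<not> P (Suc j)"] split[of "\<lambda>j. \<not> P j \<and> P (Suc j)"])
qed simp

text \<open>Only crossings from left to right are recorded; by alternation this loses a factor of
  two and an additive one.\<close>

definition left_right_pairs :: "point set \<Rightarrow> int \<Rightarrow> (point \<times> point) set" where
  "left_right_pairs S k =
     {(p, q). p \<in> S \<and> q \<in> S \<and> fst p \<le> k \<and> k < fst q \<and> snd p < snd q \<and>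
        (\<forall>r\<in>S. \<not> (snd p < snd r \<and> snd r < snd q))}"

lemma crossings_le_left_right_pairs:
  assumes S: "finite S" "semi_permutation S"
  shows "crossings S k \<le> 2 * card (left_right_pairs S k) + 1"
proof -
  define qs where "qs = sort_key snd (sorted_list_of_set S)"
  have set: "set qs = S" and dist: "distinct qs" and sorted: "sorted (map snd qs)"
    using S by (simp_all add: qs_def)
  have mono: "snd (qs ! i) < snd (qs ! j)" if "i < j" "j < length qs" for i j
  proof -
    have "snd (qs ! i) \<le> snd (qs ! j)"
      using sorted that by (auto simp: sorted_iff_nth_mono)
    moreover have "snd (qs ! i) \<noteq> snd (qs ! j)"
      using S(2) dist that set unfolding semi_permutation_def
      by (metis less_trans nth_eq_iff_index_eq nth_mem order_less_irrefl)
    ultimately show ?thesis by simp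
  qed
  define P where "P j \<longleftrightarrow> fst (qs ! j) \<le> k" for j
  let ?n = "length qs - 1"
  let ?LR = "{j. j < ?n \<and> P j \<and> \<not> P (Suc j)}" and ?RL = "{j. j < ?n \<and> \<not> P j \<and> P (Suc j)}"
  have "crossings S k = card (?LR \<union> ?RL)"
    unfolding crossings_def Let_def qs_def[symmetric] P_def by (rule arg_cong[where f = card]) auto
  also have "\<dots> \<le> card ?LR + card ?RL" by (rule card_Un_le)
  also have "\<dots> \<le> 2 * card ?LR + 1"
    using card_steps_alternate[of ?n P] by (auto simp: of_bool_def split: if_splits)
  also have "card ?LR \<le> card (left_right_pairs S k)"
  proof (rule card_inj_on_le[where f = "\<lambda>j. (qs ! j, qs ! Suc j)"])
    show "inj_on (\<lambda>j. (qs ! j, qs ! Suc j)) ?LR"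
      using dist by (auto simp: inj_on_def nth_eq_iff_index_eq)
    show "finite (left_right_pairs S k)"
      by (rule finite_subset[of _ "S \<times> S"]) (use S in \<open>auto simp: left_right_pairs_def\<close>)
    show "(\<lambda>j. (qs ! j, qs ! Suc j)) ` ?LR \<subseteq> left_right_pairs S k"
    proof (rule image_subsetI)
      fix j assume "j \<in> ?LR"
      then have j: "j < ?n" "P j" "\<not> P (Suc j)" by auto
      have "False" if r: "r \<in> S" "snd (qs ! j) < snd r" "snd r < snd (qs ! Suc j)" for r
      proof -
        obtain i where i: "i < length qs" "r = qs ! i" using r(1) set by (metis in_set_conv_nth)
        have "i < j \<or> i = j \<or> i = Suc j \<or> Suc j < i" by linarith
        moreover have "Suc j < length qs" using j(1) by simp
        ultimately show False using mono[of i j] mono[of "Suc j" i] r(2,3) i by auto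
      qed
      then show "(qs ! j, qs ! Suc j) \<in> left_right_pairs S k"
        using j mono[of j "Suc j"] set by (auto simp: left_right_pairs_def P_def)
    qed
  qed
  finally show ?thesis by simp
qed

text \<open>No point of \<open>S\<close> lies strictly between the times of a pair, so overlapping
  pairs coincide. They cannot merely touch, because a left point is never a right point.\<close>

lemma left_right_pairs_linear:
  assumes "semi_permutation S"
    and "(p, q) \<in> left_right_pairs S k" "(p', q') \<in> left_right_pairs S k"
  shows "p = p' \<and> q = q' \<or> snd q < snd p' \<or> snd q' < snd p"
proof -
  have inj: "x = y" if "x \<in> S" "y \<in> S" "snd x = snd y" for x y
    using assms(1) that by (auto simp: semi_permutation_def)
  have d: "p \<in> S" "q \<in> S" "p' \<in> S" "q' \<in> S" "snd p < snd q" "snd p' < snd q'"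
    "p \<noteq> q'" "p' \<noteq> q"
    "\<not> (snd p < snd p' \<and> snd p' < snd q)" "\<not> (snd p < snd q' \<and> snd q' < snd q)"
    "\<not> (snd p' < snd p \<and> snd p < snd q')" "\<not> (snd p' < snd q \<and> snd q < snd q')"
    using assms(2,3) by (auto simp: left_right_pairs_def)
  have "snd p \<noteq> snd q'" "snd p' \<noteq> snd q" using inj d by blast+
  then have "snd p = snd p' \<and> snd q = snd q' \<or> snd q < snd p' \<or> snd q' < snd p"
    using d(5-) by linarith
  then show ?thesis using inj d by blast
qed

section \<open>Shifted blocks\<close>

text \<open>The summand \<open>j\<close> makes the key modulo \<open>h\<close> the index of a point in its block. Hence all keys are
  distinct, and within a group of \<open>h\<close> keys \<open>h c, \<dots>, h c + h - 1\<close> the time decreases as the key grows.\<close>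

definition gap :: "nat \<Rightarrow> nat \<Rightarrow> int" where
  "gap h j = int h * 2 ^ j + int j"

lemma gap_less: "0 < h \<Longrightarrow> j < j' \<Longrightarrow> gap h j < gap h j'"
  unfolding gap_def by (intro add_less_le_mono mult_strict_left_mono) auto

lemma gap_ge: "int h \<le> gap h j"
  unfolding gap_def using mult_left_mono[of 1 "2 ^ j :: int" "int h"] by simp

definition shifted_blocks :: "nat \<Rightarrow> nat \<Rightarrow> (nat \<Rightarrow> nat) \<Rightarrow> point set" where
  "shifted_blocks h N \<beta> =
     (\<lambda>(s, r). (int h * int s + gap h (\<beta> r), int h * int s + int r)) ` ({..<N} \<times> {..<h})"

definition block :: "nat \<Rightarrow> point \<Rightarrow> nat" where
  "block h p = nat (snd p div int h)"

definition index :: "nat \<Rightarrow> point \<Rightarrow> nat" where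
  "index h p = nat (fst p mod int h)"

text \<open>The bound on \<open>WB\<close> holds for any order inside the blocks; only
  \<open>opt_ge\<close> fixes \<open>\<beta>\<close> as the bit reversal.\<close>

locale blocks =
  fixes h N :: nat and \<beta> :: "nat \<Rightarrow> nat"
  assumes h: "0 < h" and \<beta>: "bij_betw \<beta> {..<h} {..<h}"
begin

abbreviation X where "X \<equiv> shifted_blocks h N \<beta>"

lemma block_eq: "r < h \<Longrightarrow> block h (x, int h * int s + int r) = s"
  by (simp add: block_def div_add1_eq)

lemma block_eqI: "int h * int s \<le> y \<Longrightarrow> y < int h * int s + int h \<Longrightarrow> block h (x, y) = s"
  using block_eq[of "nat (y - int h * int s)" x s] by simp

lemma index_eq: "j < h \<Longrightarrow> index h (int h * int s + gap h j, y) = j"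
proof -
  assume "j < h"
  have "int h * int s + gap h j = int h * (int s + 2 ^ j) + int j"
    by (simp add: gap_def algebra_simps)
  then show ?thesis using \<open>j < h\<close> by (simp only: index_def fst_conv) simp
qed

lemma point_eq:
  assumes "p \<in> X"
  shows "block h p < N" "index h p < h" "fst p = int h * int (block h p) + gap h (index h p)"
    and "\<exists>r<h. snd p = int h * int (block h p) + int r \<and> index h p = \<beta> r"
proof -
  obtain s r where "s < N" "r < h" "p = (int h * int s + gap h (\<beta> r), int h * int s + int r)"
    using assms by (auto simp: shifted_blocks_def)
  moreover have "\<beta> r < h" using \<open>r < h\<close> \<beta> by (auto simp: bij_betw_def)
  ultimately show "block h p < N" "index h p < h"
    "fst p = int h * int (block h p) + gap h (index h p)"
    "\<exists>r<h. snd p = int h * int (block h p) + int r \<and> index h p = \<beta> r"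
    by (auto simp: block_eq index_eq)
qed

lemma point_exists:
  assumes "s < N" "j < h"
  obtains p where "p \<in> X" "block h p = s" "index h p = j"
proof -
  obtain r where r: "r < h" "j = \<beta> r" using \<beta> assms(2) unfolding bij_betw_def by blast
  show ?thesis
  proof (rule that)
    show "(int h * int s + gap h j, int h * int s + int r) \<in> X"
      using r assms(1) by (auto simp: shifted_blocks_def)
  qed (use r assms(2) in \<open>simp_all add: block_eq index_eq\<close>)
qed

lemma point_eqI:
  assumes "p \<in> X" "q \<in> X" "block h p = block h q" "index h p = index h q"
  shows "p = q"
proof -
  obtain r r' where "r < h" "snd p = int h * int (block h p) + int r" "index h p = \<beta> r"
    "r' < h" "snd q = int h * int (block h q) + int r'" "index h q = \<beta> r'"
    using point_eq(4)[OF assms(1)] point_eq(4)[OF assms(2)] by blast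
  moreover have "r = r'"
    using \<beta> calculation assms(4) by (auto simp: bij_betw_def dest: inj_onD)
  ultimately show ?thesis using point_eq(3)[OF assms(1)] point_eq(3)[OF assms(2)] assms(3,4)
    by (simp add: prod_eq_iff)
qed

lemma fst_inj:
  assumes "p \<in> X" "q \<in> X" "fst p = fst q"
  shows "p = q"
proof (rule point_eqI[OF assms(1,2)])
  show i: "index h p = index h q" using assms(3) by (simp add: index_def)
  show "block h p = block h q"
    using point_eq(3)[OF assms(1)] point_eq(3)[OF assms(2)] assms(3) i h by simp
qed

lemma snd_inj:
  assumes "p \<in> X" "q \<in> X" "snd p = snd q"
  shows "p = q"
proof (rule point_eqI[OF assms(1,2)])
  show b: "block h p = block h q" using assms(3) by (simp add: block_def)
  show "index h p = index h q"
    using point_eq(4)[OF assms(1)] point_eq(4)[OF assms(2)] assms(3) b by auto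
qed

lemma permutation_X: "permutation X"
  using fst_inj snd_inj by (auto simp: permutation_def semi_permutation_def)

lemma finite_X: "finite X"
  by (simp add: shifted_blocks_def)

lemma card_X: "card X = N * h"
proof -
  have "inj_on (\<lambda>(s, r). (int h * int s + gap h (\<beta> r), int h * int s + int r)) ({..<N} \<times> {..<h})"
  proof (rule inj_onI)
    fix a b assume ab: "a \<in> {..<N} \<times> {..<h}" "b \<in> {..<N} \<times> {..<h}"
      and eq: "(case a of (s, r) \<Rightarrow> (int h * int s + gap h (\<beta> r), int h * int s + int r))
        = (case b of (s, r) \<Rightarrow> (int h * int s + gap h (\<beta> r), int h * int s + int r))"
    obtain s r s' r' where *: "a = (s, r)" "b = (s', r')" by (cases a, cases b)
    have e: "int h * int s + int r = int h * int s' + int r'" using eq * by simp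
    have "s = block h (0, int h * int s + int r)" using block_eq ab * by simp
    also have "\<dots> = block h (0, int h * int s' + int r')" by (simp only: e)
    also have "\<dots> = s'" using block_eq ab * by simp
    finally show "a = b" using e * by simp
  qed
  then show ?thesis by (simp add: shifted_blocks_def card_image card_cartesian_product)
qed

lemma block_mono: "snd p \<le> snd q \<Longrightarrow> block h p \<le> block h q"
  using h by (auto simp: block_def intro!: nat_mono zdiv_mono1)

lemma snd_lessI: "block h p < block h q \<Longrightarrow> snd p < snd q"
  using block_mono[of q p] by linarith

text \<open>In the time band of one block, bit reversal forces an excess of at least
  \<open>i * h / 2\<close>, which the points of \<open>Y\<close> in that band must pay for. The
  bands are disjoint, so the costs of the \<open>N\<close> blocks add up.\<close>

lemma opt_ge:
  assumes "h = 2 ^ i" "\<beta> = bit_reversal i"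
  shows "real N * (real i * real h) \<le> 2 * real (opt X)"
proof -
  have band: "int i * int h \<le> 2 * int (card (Y \<inter> {p. int h * int s \<le> snd p \<and> snd p < int h * int s + int h}))"
    if Y: "finite Y" "satisfied (X \<union> Y)" and s: "s < N" for Y s
  proof -
    let ?B = "{p. int h * int s \<le> snd p \<and> snd p < int h * int s + int h}"
    let ?S = "(X \<union> Y) \<inter> ?B"
    let ?c = "\<lambda>r. int h * int s + gap h (bit_reversal i r)"
    let ?t = "\<lambda>r. int h * int s + int r"
    have XB: "X \<inter> ?B = (\<lambda>r. (?c r, ?t r)) ` {..<h}"
    proof (intro equalityI subsetI)
      fix p assume p: "p \<in> X \<inter> ?B"
      then have "block h p = s"
        using block_eqI[of s "snd p" "fst p"] by simp
      then show "p \<in> (\<lambda>r. (?c r, ?t r)) ` {..<h}"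
        using point_eq(3,4)[of p] p assms(2) by (auto simp: prod_eq_iff image_iff)
    qed (use s assms(2) in \<open>auto simp: shifted_blocks_def\<close>)
    have "finite ?S" using Y finite_X by simp
    have "int i * 2 ^ i \<le> 2 * excess ?S"
    proof (rule excess_interleaved)
      show "satisfied ?S" using Y(2) by (rule satisfied_band)
      show "interleaved i ?c"
        by (rule interleaved_bit_reversal[where f = "\<lambda>j. int h * int s + gap h j"])
           (simp add: gap_less h)
      show "(?c r, ?t r) \<in> ?S" if "r < 2 ^ i" for r
        using XB that assms(1) by auto
    qed (use \<open>finite ?S\<close> in auto)
    \<comment> \<open>Within the band, \<open>X\<close> has \<open>h\<close> points in
      \<open>h\<close> rows; uniting with \<open>Y\<close> loses no row and adds at most the points
      of \<open>Y\<close>.\<close>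
    moreover have "excess ?S \<le> int (card (Y \<inter> ?B))"
    proof -
      have inj: "inj_on ?t {..<h}" "inj_on (\<lambda>r. (?c r, ?t r)) {..<h}" by (auto simp: inj_on_def)
      have "snd ` (X \<inter> ?B) = ?t ` {..<h}" unfolding XB by (auto simp: image_iff)
      then have "card (snd ` (X \<inter> ?B)) = h" using inj(1) by (simp add: card_image)
      moreover have "card (X \<inter> ?B) = h" unfolding XB using inj(2) by (simp add: card_image)
      moreover have "card ?S \<le> card (X \<inter> ?B) + card (Y \<inter> ?B)"
        by (subst Int_Un_distrib2) (rule card_Un_le)
      moreover have "card (snd ` (X \<inter> ?B)) \<le> card (snd ` ?S)"
        using \<open>finite ?S\<close> by (intro card_mono) auto
      ultimately show ?thesis by (simp add: excess_def)
    qed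
    ultimately show ?thesis using assms(1) by simp
  qed
  have feasible: "N * (i * h) \<le> 2 * card Y" if Y: "finite Y" "satisfied (X \<union> Y)" for Y
  proof -
    let ?B = "\<lambda>s. {p :: point. int h * int s \<le> snd p \<and> snd p < int h * int s + int h}"
    have less: "?B s \<inter> ?B s' = {}" if "s < s'" for s s'
    proof -
      have "int h * int s + int h \<le> int h * int s'"
        using mult_left_mono[of "int s + 1" "int s'" "int h"] that by (simp add: algebra_simps)
      then show ?thesis by auto
    qed
    have disj: "?B s \<inter> ?B s' = {}" if "s \<noteq> s'" for s s'
    proof (cases "s < s'")
      case False
      then have "?B s' \<inter> ?B s = {}" using that by (intro less) simp
      then show ?thesis by (simp only: Int_commute)
    qed (rule less)
    have "N * (i * h) = (\<Sum>s<N. i * h)" by simp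
    also have "\<dots> \<le> (\<Sum>s<N. 2 * card (Y \<inter> ?B s))"
    proof (rule sum_mono)
      fix s assume "s \<in> {..<N}"
      then have "int (i * h) \<le> int (2 * card (Y \<inter> ?B s))" using band[OF Y, of s] by simp
      then show "i * h \<le> 2 * card (Y \<inter> ?B s)" by (simp only: of_nat_le_iff)
    qed
    also have "\<dots> = 2 * card (\<Union>s<N. Y \<inter> ?B s)"
      using Y(1) disj by (subst card_UN_disjoint) (auto simp: sum_distrib_left)
    also have "card (\<Union>s<N. Y \<inter> ?B s) \<le> card Y"
      using Y(1) by (intro card_mono) auto
    finally show ?thesis by simp
  qed
  let ?K = "{card Y |Y. finite Y \<and> satisfied (X \<union> Y)}"
  have "opt X \<in> ?K" unfolding opt_def
  proof (rule Inf_nat_def1)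
    \<comment> \<open>The grid of all keys and times contains a corner of every box, so it is a
      feasible completion. Hence the infimum is over a nonempty set and is attained.\<close>
    let ?Z = "fst ` X \<times> snd ` X"
    have "pair_satisfied (X \<union> ?Z) p q"
      if "p \<in> X \<union> ?Z" "q \<in> X \<union> ?Z" "\<not> collinear p q" for p q
    proof -
      have "(fst p, snd q) \<in> X \<union> ?Z" using that(1,2) by force
      moreover have "in_box p q (fst p, snd q)" by (auto simp: in_box_def)
      ultimately show ?thesis using that(3) unfolding pair_satisfied_def
        by (intro bexI[of _ "(fst p, snd q)"]) (auto simp: collinear_def prod_eq_iff)
    qed
    then have "satisfied (X \<union> ?Z)" by (simp add: satisfied_def)
    moreover have "finite ?Z" using finite_X by simp
    ultimately show "?K \<noteq> {}" by blast
  qed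
  then obtain Y where "opt X = card Y" "finite Y" "satisfied (X \<union> Y)" by blast
  then have "N * (i * h) \<le> 2 * opt X" using feasible by simp
  then have "real (N * (i * h)) \<le> real (2 * opt X)" by (simp only: of_nat_le_iff)
  then show ?thesis by simp
qed

end

section \<open>Crossings in a strip\<close>

text \<open>A half-open window of length \<open>l\<close> contains at most \<open>l / h + 1\<close>
  multiples of \<open>h\<close>; scaling by \<open>h\<close> avoids division.\<close>

lemma card_multiples_le:
  assumes "0 < h" "0 \<le> (l :: int)"
  shows "int h * int (card {s. s < N \<and> A < int h * int s \<and> int h * int s \<le> A + l}) \<le> l + int h"
proof -
  let ?T = "{s. s < N \<and> A < int h * int s \<and> int h * int s \<le> A + l}"
  have "int ` ?T \<subseteq> {A div int h<..(A + l) div int h}"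
  proof (rule image_subsetI)
    fix s assume s: "s \<in> ?T"
    then have "(int h * int s) div int h \<le> (A + l) div int h"
      using assms(1) by (intro zdiv_mono1) auto
    moreover have "A div int h < int s"
    proof (rule ccontr)
      assume "\<not> A div int h < int s"
      then have "int h * int s \<le> int h * (A div int h)" by (intro mult_left_mono) auto
      also have "\<dots> \<le> A" using mult_div_mod_eq[of "int h" A] pos_mod_sign[of "int h" A] assms(1) by linarith
      finally show False using s by simp
    qed
    ultimately show "int s \<in> {A div int h<..(A + l) div int h}" using assms(1) by simp
  qed
  then have "card (int ` ?T) \<le> card {A div int h<..(A + l) div int h}"
    by (intro card_mono) auto
  then have "card ?T \<le> nat ((A + l) div int h - A div int h)"
    by (simp add: card_image)
  moreover have "A div int h \<le> (A + l) div int h" using assms by (intro zdiv_mono1) auto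
  ultimately have "int (card ?T) \<le> (A + l) div int h - A div int h" by linarith
  then have "int h * int (card ?T) \<le> int h * ((A + l) div int h) - int h * (A div int h)"
    unfolding right_diff_distrib[symmetric] by (rule mult_left_mono) simp
  also have "\<dots> \<le> l + int h"
    using mult_div_mod_eq[of "int h" A] mult_div_mod_eq[of "int h" "A + l"]
      pos_mod_bound[of "int h" A] pos_mod_sign[of "int h" "A + l"] assms(1) by linarith
  finally show ?thesis .
qed

lemma sum_card_swap:
  assumes "finite J"
  shows "(\<Sum>s<N. card {j \<in> J. Q s j}) = (\<Sum>j\<in>J. card {s. s < (N::nat) \<and> Q s j})"
proof -
  have "(\<Sum>s<N. card {j \<in> J. Q s j}) = (\<Sum>s<N. \<Sum>j\<in>J. of_bool (Q s j))"
    using assms by (simp add: Int_def)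
  also have "\<dots> = (\<Sum>j\<in>J. \<Sum>s<N. of_bool (Q s j))" by (rule sum.swap)
  also have "\<dots> = (\<Sum>j\<in>J. card {s. s < N \<and> Q s j})"
    by (simp add: Int_def)
  finally show ?thesis .
qed

text \<open>For two points, \<open>d\<close> will be the difference of their columns and
  \<open>e\<close> that of their indices: at a distance below \<open>h\<close> the columns are equal
  or adjacent.\<close>

lemma short_difference:
  fixes d e h :: int
  assumes "0 < h * d + e" "h * d + e < h" "- h < e" "e < h"
  shows "d = 0 \<and> 0 < e \<or> d = 1 \<and> e < 0"
proof -
  have "d < 2"
  proof (rule ccontr)
    assume "\<not> d < 2"
    then have "h * 2 \<le> h * d" using assms by (intro mult_left_mono) auto
    then show False using assms by linarith
  qed
  moreover have "- 1 < d"
  proof (rule ccontr)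
    assume "\<not> - 1 < d"
    then have "h * d \<le> h * (- 1)" using assms by (intro mult_left_mono) auto
    then show False using assms by linarith
  qed
  ultimately have "d = 0 \<or> d = 1" by linarith
  then show ?thesis using assms by auto
qed

section \<open>Left-to-right crossings in narrow and in general strips\<close>

context blocks
begin

text \<open>On \<open>X\<close> this is \<open>fst p div int h\<close>, the number of the group of
  \<open>h\<close> keys containing the key of \<open>p\<close>.\<close>

definition column :: "point \<Rightarrow> int" where
  "column p = int (block h p) + 2 ^ index h p"

lemma fst_eq_column: "p \<in> X \<Longrightarrow> fst p = int h * column p + int (index h p)"
  by (simp add: point_eq(3) column_def gap_def algebra_simps)

definition strip :: "int \<Rightarrow> int \<Rightarrow> point set" where
  "strip a b = {p \<in> X. a \<le> fst p \<and> fst p < b}"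

lemma strip_finite: "finite (strip a b)"
  using finite_X by (simp add: strip_def)

lemma strip_semi: "semi_permutation (strip a b)"
  using snd_inj by (auto simp: semi_permutation_def strip_def)

text \<open>A narrow strip meets at most two consecutive columns, and there all points of the second one are
  later than all points of the first one.\<close>

lemma card_left_right_pairs_narrow:
  assumes "b - a \<le> int h"
  shows "card (left_right_pairs (strip a b) k) \<le> 1"
proof -
  let ?P = "left_right_pairs (strip a b) k"
  \<comment> \<open>A pair goes right and forward in time. Within one column, going right means a
    larger index and hence an earlier block, so the pair must enter the next column.\<close>
  have step: "column q = column p + 1 \<and> index h q < index h p" if "(p, q) \<in> ?P" for p q
  proof -
    have X: "p \<in> X" "q \<in> X" and fst: "fst p < fst q" "fst q - fst p < int h" and snd: "snd p < snd q"
      using that assms by (auto simp: left_right_pairs_def strip_def)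
    have b: "block h p \<le> block h q" using snd by (simp add: block_mono)
    let ?d = "column q - column p" and ?e = "int (index h q) - int (index h p)"
    have "fst q - fst p = int h * ?d + ?e"
      by (simp add: fst_eq_column X algebra_simps)
    then have "?d = 0 \<and> 0 < ?e \<or> ?d = 1 \<and> ?e < 0"
      using fst point_eq(2)[OF X(1)] point_eq(2)[OF X(2)] by (intro short_difference[of "int h"]) auto
    moreover have "\<not> (?d = 0 \<and> 0 < ?e)"
    proof
      assume *: "?d = 0 \<and> 0 < ?e"
      then have "(2::int) ^ index h p < 2 ^ index h q" by simp
      then show False using * b unfolding column_def by linarith
    qed
    ultimately show ?thesis by auto
  qed
  \<comment> \<open>If \<open>q\<close> came before \<open>p'\<close>, then either they share a
    column and \<open>q'\<close> is two columns beyond \<open>p\<close>, too far for the strip, or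
    \<open>q\<close> is in the column after \<open>p'\<close> with a smaller index, which requires a
    later block.\<close>
  have no: "\<not> snd q < snd p'" if "(p, q) \<in> ?P" "(p', q') \<in> ?P" for p q p' q'
  proof
    assume "snd q < snd p'"
    then have b: "block h q \<le> block h p'" by (simp add: block_mono)
    have X: "p \<in> X" "q \<in> X" "p' \<in> X" "q' \<in> X" and fst: "0 < fst q - fst p'"  "fst q - fst p' < int h"
      "fst q' - fst p < int h"
      using that assms by (auto simp: left_right_pairs_def strip_def)
    let ?d = "column q - column p'" and ?e = "int (index h q) - int (index h p')"
    have "fst q - fst p' = int h * ?d + ?e"
      by (simp add: fst_eq_column X algebra_simps)
    then have "?d = 0 \<and> 0 < ?e \<or> ?d = 1 \<and> ?e < 0"
      using fst point_eq(2)[OF X(2)] point_eq(2)[OF X(3)] by (intro short_difference[of "int h"]) auto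
    then show False
    proof
      assume "?d = 0 \<and> 0 < ?e"
      then have "column q' = column p + 2" using step[OF that(1)] step[OF that(2)] by linarith
      then have "fst q' - fst p = 2 * int h + int (index h q') - int (index h p)"
        using X by (simp add: fst_eq_column algebra_simps)
      then show False using fst point_eq(2)[OF X(1)] by linarith
    next
      assume *: "?d = 1 \<and> ?e < 0"
      then have "(2::int) ^ index h q < 2 ^ index h p'" by simp
      then show False using * b unfolding column_def by linarith
    qed
  qed
  have "P = Q" if "P \<in> ?P" "Q \<in> ?P" for P Q
    using left_right_pairs_linear[OF strip_semi, of "fst P" "snd P" a b k "fst Q" "snd Q"]
      no[of "fst P" "snd P" "fst Q" "snd Q"] no[of "fst Q" "snd Q" "fst P" "snd P"] that
    by (auto simp: prod_eq_iff)
  then show ?thesis by (cases "finite ?P") (auto simp: card_le_Suc0_iff_eq)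
qed

lemma left_right_pairs_strip_finite: "finite (left_right_pairs (strip a b) k)"
  by (rule finite_subset[of _ "strip a b \<times> strip a b"]) (auto simp: left_right_pairs_def strip_finite)

text \<open>Distinct pairs are disjoint in time, so either endpoint determines the pair. Pairs can
  then be counted through the keys, indices or blocks of one endpoint.\<close>

lemma left_right_pairs_inj:
  assumes "(p, q) \<in> left_right_pairs (strip a b) k" "(p', q') \<in> left_right_pairs (strip a b) k"
    and "p = p' \<or> q = q'"
  shows "p = p' \<and> q = q'"
  using left_right_pairs_linear[OF strip_semi assms(1,2)] assms
  by (auto simp: left_right_pairs_def)

lemma inj_on_left_point:
  assumes "inj_on f (fst ` A)" "A \<subseteq> left_right_pairs (strip a b) k"
  shows "inj_on (\<lambda>P. f (fst P)) A"
proof (rule inj_onI)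
  fix P Q assume P: "P \<in> A" "Q \<in> A" "f (fst P) = f (fst Q)"
  then have "fst P = fst Q" using assms(1) by (simp add: inj_on_eq_iff)
  then show "P = Q"
    using left_right_pairs_inj[of "fst P" "snd P" a b k "fst Q" "snd Q"] assms(2) P
    by (auto simp: prod_eq_iff)
qed

lemma inj_on_right_point:
  assumes "inj_on f (snd ` A)" "A \<subseteq> left_right_pairs (strip a b) k"
  shows "inj_on (\<lambda>P. f (snd P)) A"
proof (rule inj_onI)
  fix P Q assume P: "P \<in> A" "Q \<in> A" "f (snd P) = f (snd Q)"
  then have "snd P = snd Q" using assms(1) by (simp add: inj_on_eq_iff)
  then show "P = Q"
    using left_right_pairs_inj[of "fst P" "snd P" a b k "fst Q" "snd Q"] assms(2) P
    by (auto simp: prod_eq_iff)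
qed

lemma left_right_pairs_subset: "left_right_pairs (strip a b) k \<subseteq> X \<times> X"
  by (auto simp: left_right_pairs_def strip_def)

lemma inj_on_fst_subset: "A \<subseteq> X \<Longrightarrow> inj_on fst A"
  using fst_inj by (blast intro: inj_onI)

lemma inj_on_index_block:
  assumes "A \<subseteq> X" "\<And>p. p \<in> A \<Longrightarrow> block h p = s"
  shows "inj_on (index h) A"
  using assms by (intro inj_onI point_eqI) auto

text \<open>Keys are distinct, so each pair uses up a key of its own on both sides. This serves for
  cuts whose narrower side has at most \<open>h\<close> keys.\<close>

lemma card_left_right_pairs_le_width:
  assumes "a \<le> k" "k + 1 < b"
  shows "int (card (left_right_pairs (strip a b) k)) \<le> min (k + 1 - a) (b - 1 - k)"
proof -
  let ?P = "left_right_pairs (strip a b) k"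
  have "card ?P \<le> card {a..k}"
  proof (rule card_inj_on_le[where f = "\<lambda>P. fst (fst P)"])
    show "inj_on (\<lambda>P. fst (fst P)) ?P"
      using left_right_pairs_subset[of a b k] by (intro inj_on_left_point inj_on_fst_subset) auto
  qed (auto simp: left_right_pairs_def strip_def)
  moreover have "card ?P \<le> card {k+1..<b}"
  proof (rule card_inj_on_le[where f = "\<lambda>P. fst (snd P)"])
    show "inj_on (\<lambda>P. fst (snd P)) ?P"
      using left_right_pairs_subset[of a b k] by (intro inj_on_right_point inj_on_fst_subset) auto
  qed (auto simp: left_right_pairs_def strip_def)
  ultimately show ?thesis using assms by (simp add: le_nat_iff)
qed

definition left_indices :: "int \<Rightarrow> int \<Rightarrow> nat \<Rightarrow> nat set" where
  "left_indices a k s = {j. j < h \<and> a \<le> int h * int s + gap h j \<and> int h * int s + gap h j \<le> k}"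

definition right_indices :: "int \<Rightarrow> int \<Rightarrow> nat \<Rightarrow> nat set" where
  "right_indices b k s = {j. j < h \<and> k < int h * int s + gap h j \<and> int h * int s + gap h j < b}"

lemma indices_finite: "finite (left_indices a k s)" "finite (right_indices b k s)"
  by (simp_all add: left_indices_def right_indices_def)

text \<open>A pair \<open>(p, q)\<close> inside one block is charged to that block. Otherwise the copy of \<open>p\<close> in the
  next block lies \<open>h\<close> to the right of \<open>p\<close>. If it is still left of the line, then \<open>q\<close> must
  belong to that block as well, which thus meets both sides and is charged; if not, then \<open>p\<close> is
  one of the last \<open>h\<close> keys before the line.\<close>

lemma card_left_right_pairs_le_sum:
  "card (left_right_pairs (strip a b) k)
    \<le> 2 * (\<Sum>s<N. min (card (left_indices a k s)) (card (right_indices b k s))) + h"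
proof -
  let ?P = "left_right_pairs (strip a b) k"
  let ?m = "\<lambda>s. min (card (left_indices a k s)) (card (right_indices b k s))"
  note fin = left_right_pairs_strip_finite[of a b k]
  have PD: "p \<in> X" "q \<in> X" "snd p < snd q" "index h p \<in> left_indices a k (block h p)"
    "index h q \<in> right_indices b k (block h q)" "block h p \<le> block h q" if "(p, q) \<in> ?P" for p q
    using that block_mono[of p q] point_eq(2,3)[of p] point_eq(2,3)[of q]
    by (auto simp: left_right_pairs_def strip_def left_indices_def right_indices_def)
  let ?A = "\<lambda>s. {(p, q). (p, q) \<in> ?P \<and> block h p = s \<and> block h q = s}"
  let ?B = "{(p, q). (p, q) \<in> ?P \<and> block h p < block h q \<and> fst p + int h \<le> k}"
  let ?C = "{(p, q). (p, q) \<in> ?P \<and> k < fst p + int h}"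
  have finA: "finite (?A s)" for s by (rule finite_subset[OF _ fin]) auto
  have "card (?A s) \<le> ?m s" for s
  proof -
    have "card (?A s) \<le> card (left_indices a k s)"
    proof (rule card_inj_on_le[where f = "\<lambda>P. index h (fst P)"])
      show "inj_on (\<lambda>P. index h (fst P)) (?A s)"
        using left_right_pairs_subset[of a b k]
        by (intro inj_on_left_point[where a = a and b = b and k = k] inj_on_index_block[where s = s]) auto
    qed (use PD indices_finite in auto)
    moreover have "card (?A s) \<le> card (right_indices b k s)"
    proof (rule card_inj_on_le[where f = "\<lambda>P. index h (snd P)"])
      show "inj_on (\<lambda>P. index h (snd P)) (?A s)"
        using left_right_pairs_subset[of a b k]
        by (intro inj_on_right_point[where a = a and b = b and k = k] inj_on_index_block[where s = s]) auto
      show "(\<lambda>P. index h (snd P)) ` ?A s \<subseteq> right_indices b k s"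
      proof (rule image_subsetI)
        fix P assume "P \<in> ?A s"
        then have "(fst P, snd P) \<in> ?P" "block h (snd P) = s" by auto
        then show "index h (snd P) \<in> right_indices b k s" using PD(5) by blast
      qed
    qed (rule indices_finite)
    ultimately show ?thesis by simp
  qed
  then have "(\<Sum>s<N. card (?A s)) \<le> (\<Sum>s<N. ?m s)" by (rule sum_mono)
  moreover have "card (\<Union>s<N. ?A s) \<le> (\<Sum>s<N. card (?A s))"
    by (rule card_UN_le) simp
  ultimately have A: "card (\<Union>s<N. ?A s) \<le> (\<Sum>s<N. ?m s)" by linarith
  \<comment> \<open>Here \<open>r\<close> is the copy of \<open>p\<close> in the next block. It
    follows \<open>p\<close> inside the strip, so \<open>q\<close> cannot come after
    \<open>r\<close> and lies in that block. Strip points before \<open>q\<close> come no later than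
    \<open>p\<close>, so \<open>q\<close> is the first strip point of its block.\<close>
  have Bmem: "left_indices a k (block h q) \<noteq> {} \<and> (\<forall>r\<in>strip a b. snd r < snd q \<longrightarrow> block h r < block h q)"
    if "(p, q) \<in> ?B" for p q
  proof -
    have pq: "(p, q) \<in> ?P" "block h p < block h q" "fst p + int h \<le> k" using that by auto
    note D = PD[OF pq(1)]
    have "block h p + 1 < N" using pq(2) point_eq(1)[OF D(2)] by simp
    then obtain r where r: "r \<in> X" "block h r = block h p + 1" "index h r = index h p"
      using point_exists point_eq(2)[OF D(1)] by blast
    have "fst r = fst p + int h"
      using point_eq(3)[OF r(1)] point_eq(3)[OF D(1)] r by (simp add: algebra_simps)
    then have rs: "r \<in> strip a b" and "fst r \<le> k"
      using pq(1,3) r(1) by (auto simp: left_right_pairs_def strip_def)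
    have "snd p < snd r" using r by (intro snd_lessI) simp
    then have "snd q \<le> snd r" using pq(1) rs by (fastforce simp: left_right_pairs_def)
    then have bq: "block h q = block h p + 1"
      using block_mono[of q r] pq(2) r(2) by simp
    have "index h r \<in> left_indices a k (block h q)"
      using rs \<open>fst r \<le> k\<close> point_eq(2,3)[OF r(1)] r(2) bq by (auto simp: left_indices_def strip_def)
    moreover have "block h t < block h q" if "t \<in> strip a b" "snd t < snd q" for t
    proof -
      have "snd t \<le> snd p" using pq(1) that by (fastforce simp: left_right_pairs_def)
      then show ?thesis using block_mono[of t p] pq(2) by simp
    qed
    ultimately show ?thesis by auto
  qed
  \<comment> \<open>Being the first strip point of its block, \<open>q\<close> is determined by the
    block, so the charge is injective; a block meeting both sides has minimum at least one.\<close>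
  have B: "card ?B \<le> (\<Sum>s<N. ?m s)"
  proof -
    have "card ?B \<le> card {s. s < N \<and> 1 \<le> ?m s}"
    proof (rule card_inj_on_le[where f = "\<lambda>P. block h (snd P)"])
      show "inj_on (\<lambda>P. block h (snd P)) ?B"
      proof (intro inj_on_right_point[where a = a and b = b and k = k] inj_onI)
        fix q q' assume q: "q \<in> snd ` ?B" "q' \<in> snd ` ?B" and eq: "block h q = block h q'"
        then obtain p p' where pq: "(p, q) \<in> ?B" "(p', q') \<in> ?B" by fastforce
        have qs: "q \<in> strip a b" "q' \<in> strip a b" using pq by (auto simp: left_right_pairs_def)
        then have "\<not> snd q < snd q'" "\<not> snd q' < snd q"
          using Bmem[OF pq(1)] Bmem[OF pq(2)] eq by fastforce+
        then have "snd q = snd q'" by linarith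
        moreover have "q \<in> X" "q' \<in> X" using qs by (auto simp: strip_def)
        ultimately show "q = q'" using snd_inj by blast
      qed auto
      show "(\<lambda>P. block h (snd P)) ` ?B \<subseteq> {s. s < N \<and> 1 \<le> ?m s}"
      proof (rule image_subsetI)
        fix P assume "P \<in> ?B"
        then obtain p q where e: "P = (p, q)" "(p, q) \<in> ?B" "(p, q) \<in> ?P" by auto
        have "left_indices a k (block h q) \<noteq> {}" "right_indices b k (block h q) \<noteq> {}"
          using Bmem[OF e(2)] PD(5)[OF e(3)] by auto
        then have "0 < card (left_indices a k (block h q))" "0 < card (right_indices b k (block h q))"
          using indices_finite by (simp_all add: card_gt_0_iff)
        then show "block h (snd P) \<in> {s. s < N \<and> 1 \<le> ?m s}"
          using point_eq(1)[OF PD(2)[OF e(3)]] e(1) by simp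
      qed
    qed simp
    also have "\<dots> = (\<Sum>s\<in>{s. s < N \<and> 1 \<le> ?m s}. 1)" by simp
    also have "\<dots> \<le> (\<Sum>s\<in>{s. s < N \<and> 1 \<le> ?m s}. ?m s)" by (rule sum_mono) simp
    also have "\<dots> \<le> (\<Sum>s<N. ?m s)" by (rule sum_mono2) auto
    finally show ?thesis .
  qed
  have C: "card ?C \<le> h"
  proof -
    have "card ?C \<le> card {k - int h<..k}"
    proof (rule card_inj_on_le[where f = "\<lambda>P. fst (fst P)"])
      show "inj_on (\<lambda>P. fst (fst P)) ?C"
        using left_right_pairs_subset[of a b k]
        by (intro inj_on_left_point[where a = a and b = b and k = k] inj_on_fst_subset) auto
    qed (auto simp: left_right_pairs_def strip_def)
    then show ?thesis by simp
  qed
  have "?P \<subseteq> (\<Union>s<N. ?A s) \<union> ?B \<union> ?C"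
  proof
    fix P assume P: "P \<in> ?P"
    obtain p q where e: "P = (p, q)" by (cases P)
    have "block h p < N" using PD(1)[of p q] P e point_eq(1) by simp
    then show "P \<in> (\<Union>s<N. ?A s) \<union> ?B \<union> ?C"
      using P e PD(6)[of p q] by (cases "block h p = block h q"; cases "k < fst p + int h") auto
  qed
  moreover have "finite ((\<Union>s<N. ?A s) \<union> ?B \<union> ?C)"
    by (rule finite_subset[OF _ fin]) auto
  ultimately have "card ?P \<le> card ((\<Union>s<N. ?A s) \<union> ?B \<union> ?C)" by (intro card_mono) auto
  also have "\<dots> \<le> card (\<Union>s<N. ?A s) + card ?B + card ?C"
    by (meson add_mono card_Un_le le_refl order_trans)
  finally show ?thesis using A B C by linarith
qed

end

section \<open>Sums over powers of two\<close>

lemma sum_small_powers_le: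
  assumes "0 \<le> (M :: real)"
  shows "(\<Sum>j | j < n \<and> 2 ^ j < M. 2 ^ j) \<le> 2 * M"
proof (induction n)
  case 0
  then show ?case using assms by simp
next
  case (Suc n)
  show ?case
  proof (cases "2 ^ n < M")
    case True
    have "{j. j < Suc n \<and> 2 ^ j < M} = {..<Suc n}"
    proof (intro equalityI subsetI)
      fix j assume "j \<in> {..<Suc n}"
      then have "(2::real) ^ j \<le> 2 ^ n" by (intro power_increasing) auto
      then have "2 ^ j < M" using True by linarith
      then show "j \<in> {j. j < Suc n \<and> 2 ^ j < M}" using \<open>j \<in> {..<Suc n}\<close> by simp
    qed auto
    moreover have "(\<Sum>j<m. 2 ^ j) = (2::real) ^ m - 1" for m by (induction m) auto
    ultimately show ?thesis using True by simp
  next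
    case False
    then have "{j. j < Suc n \<and> 2 ^ j < M} = {j. j < n \<and> 2 ^ j < M}"
      by (auto simp: less_Suc_eq)
    then show ?thesis using Suc by simp
  qed
qed

text \<open>The exponents lie in an interval of length \<open>log 2 (y / x)\<close>; rounding its
  ends costs at most one.\<close>

lemma card_power_range_le:
  assumes "0 < x" "x \<le> y"
  shows "real (card {j. j < n \<and> x \<le> 2 ^ j \<and> 2 ^ j < (y :: real)}) \<le> log 2 (y / x) + 1"
proof -
  let ?T = "{j. j < n \<and> x \<le> 2 ^ j \<and> 2 ^ j < y}"
  have T: "log 2 x \<le> real j \<and> real j < log 2 y" if "j \<in> ?T" for j
  proof
    show "log 2 x \<le> real j"
      using that assms by (subst log_le_iff) (auto simp: powr_realpow)
    show "real j < log 2 y"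
      using that assms by (subst less_log_iff) (auto simp: powr_realpow)
  qed
  have "int ` ?T \<subseteq> {\<lceil>log 2 x\<rceil>..<\<lceil>log 2 y\<rceil>}"
  proof (rule image_subsetI)
    fix j assume "j \<in> ?T"
    from T[OF this] show "int j \<in> {\<lceil>log 2 x\<rceil>..<\<lceil>log 2 y\<rceil>}"
      by (simp add: ceiling_le_iff less_ceiling_iff)
  qed
  then have "card (int ` ?T) \<le> card {\<lceil>log 2 x\<rceil>..<\<lceil>log 2 y\<rceil>}" by (intro card_mono) auto
  then have "card ?T \<le> nat (\<lceil>log 2 y\<rceil> - \<lceil>log 2 x\<rceil>)" by (simp add: card_image)
  moreover have "log 2 x \<le> log 2 y" using assms by simp
  then have "\<lceil>log 2 x\<rceil> \<le> \<lceil>log 2 y\<rceil>" by (rule ceiling_mono)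
  ultimately have "real (card ?T) \<le> real_of_int (\<lceil>log 2 y\<rceil> - \<lceil>log 2 x\<rceil>)" by linarith
  also have "\<dots> \<le> log 2 y - log 2 x + 1"
    using ceiling_correct[of "log 2 x"] ceiling_correct[of "log 2 y"] by linarith
  also have "\<dots> = log 2 (y / x) + 1" using assms by (simp add: log_divide)
  finally show ?thesis .
qed

text \<open>Powers below \<open>M\<close> sum geometrically to at most \<open>2 * M\<close>; the
  remaining exponents number at most \<open>log 2 (W / M) + 2\<close> and contribute at most
  \<open>M\<close> each. As \<open>2 * M \<le> W\<close>, the logarithm is at least one and absorbs
  the resulting \<open>4 * M\<close>.\<close>

lemma sum_min_powers_le:
  assumes "1 \<le> M" "2 * M \<le> W"
  shows "(\<Sum>j | j < n \<and> 2 ^ j < 2 * W. min M (2 ^ j)) \<le> 5 * M * log 2 (W / M)"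
proof -
  let ?J = "{j. j < n \<and> 2 ^ j < 2 * W}"
  let ?A = "{j. j < n \<and> 2 ^ j < M}" and ?B = "{j. j < n \<and> M \<le> 2 ^ j \<and> 2 ^ j < 2 * W}"
  have J: "?J = ?A \<union> ?B" using assms by auto
  have "?A \<inter> ?B = {}" by auto
  then have "(\<Sum>j\<in>?J. min M (2 ^ j)) = (\<Sum>j\<in>?A. min M (2 ^ j)) + (\<Sum>j\<in>?B. min M (2 ^ j))"
    unfolding J by (intro sum.union_disjoint) simp_all
  also have "(\<Sum>j\<in>?A. min M (2 ^ j)) \<le> (\<Sum>j\<in>?A. 2 ^ j)" by (rule sum_mono) simp
  also have "\<dots> \<le> 2 * M" using assms by (intro sum_small_powers_le) simp
  also have "(\<Sum>j\<in>?B. min M (2 ^ j)) \<le> (\<Sum>j\<in>?B. M)" by (rule sum_mono) simp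
  also have "\<dots> = real (card ?B) * M" by simp
  also have "\<dots> \<le> (log 2 (2 * W / M) + 1) * M"
    using assms by (intro mult_right_mono card_power_range_le) auto
  also have "log 2 (2 * W / M) = 1 + log 2 (W / M)"
    using assms by (simp add: log_mult log_divide)
  also have "2 * M + (1 + log 2 (W / M) + 1) * M = 4 * M + M * log 2 (W / M)"
    by (simp add: algebra_simps)
  also have "\<dots> \<le> 5 * M * log 2 (W / M)"
  proof -
    have "1 \<le> log 2 (W / M)" using assms by (subst le_log_iff) (auto simp: field_simps)
    then have "M * 1 \<le> M * log 2 (W / M)" using assms by (intro mult_left_mono) auto
    then show ?thesis by simp
  qed
  finally show ?thesis by simp
qed

section \<open>Averaging over the block shifts\<close>

context blocks
begin

text \<open>With \<open>m\<close> the width of the narrower side, each minimum is bounded by one of its two arguments so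
  that, for every index \<open>j\<close>, the relevant blocks start in a window of width \<open>min m (gap h j)\<close>. A block
  meeting both sides only uses indices \<open>j\<close> with \<open>h 2^j < 2 (b - a)\<close>.\<close>

lemma sum_min_indices_le:
  fixes a b k :: int
  assumes "a \<le> k" "k + 1 < b"
  defines "m \<equiv> min (k + 1 - a) (b - 1 - k)"
  defines "J \<equiv> {j. j < h \<and> int h * 2 ^ j < 2 * (b - a)}"
  shows "int h * int (\<Sum>s<N. min (card (left_indices a k s)) (card (right_indices b k s)))
    \<le> 3 * (\<Sum>j\<in>J. min m (gap h j) + int h)"
proof -
  \<comment> \<open>A window for the shift \<open>h * s\<close>, one for each index
    \<open>j\<close>; the left ends \<open>A1\<close>, \<open>A2\<close>, \<open>A3\<close> belong
    to the three cases below.\<close>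
  define In where "In A j s \<longleftrightarrow> A j < int h * int s \<and> int h * int s \<le> A j + min m (gap h j)"
    for A :: "nat \<Rightarrow> int" and j s
  define A1 where "A1 j = k - gap h j" for j
  define A2 where "A2 j = k - min m (gap h j)" for j
  define A3 where "A3 j = k - m - gap h j" for j
  have finJ: "finite J" by (simp add: J_def)
  have m: "0 \<le> m" using assms by (simp add: m_def)
  have pointwise: "min (card (left_indices a k s)) (card (right_indices b k s))
      \<le> card {j \<in> J. In A1 j s} + card {j \<in> J. In A2 j s} + card {j \<in> J. In A3 j s}" (is "?l \<le> ?r") for s
  proof (cases "left_indices a k s = {} \<or> right_indices b k s = {}")
    case False
    then obtain jl jr where jl: "jl \<in> left_indices a k s" and jr: "jr \<in> right_indices b k s" by blast
    \<comment> \<open>Exponential spacing: the two keys differ by at least half of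
      \<open>h * 2 ^ j'\<close>, and by less than the width \<open>b - a\<close>.\<close>
    have order: "j < j' \<and> int h * 2 ^ j' < 2 * (b - a) \<and> int h * 2 ^ j < 2 * (b - a)"
      if "j \<in> left_indices a k s" "j' \<in> right_indices b k s" for j j'
    proof -
      have lt: "gap h j < gap h j'" "gap h j' - gap h j < b - a"
        using that by (auto simp: left_indices_def right_indices_def)
      have "j < j'"
      proof (rule ccontr)
        assume "\<not> j < j'"
        then have "j = j' \<or> j' < j" by linarith
        then show False using lt(1) gap_less[OF h, of j' j] by auto
      qed
      then have double: "2 * (int h * 2 ^ j) \<le> int h * 2 ^ j'"
        using mult_left_mono[OF power_increasing[of "Suc j" j' "2::int"], of "int h"]
        by (simp add: ac_simps)
      have diff: "gap h j' - gap h j = int h * 2 ^ j' - int h * 2 ^ j + (int j' - int j)"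
        by (simp add: gap_def)
      have "x' < 2 * d \<and> x < 2 * d"
        if "2 * x \<le> x'" "g = x' - x + e" "g < d" "0 \<le> x" "0 < e" for x x' g d e :: int
        using that by auto
      from this[OF double diff lt(2)] show ?thesis using \<open>j < j'\<close> by simp
    qed
    have LJ: "left_indices a k s \<subseteq> J" and RJ: "right_indices b k s \<subseteq> J"
      using order jl jr by (auto simp: J_def left_indices_def right_indices_def)
    have s: "int h * int s \<le> k"
      using jl gap_ge[of h jl] by (auto simp: left_indices_def)
    \<comment> \<open>If the right side is narrower, right points are counted. If the left side is
      narrower, right points are counted for shifts among the last \<open>m\<close> integers up to
      \<open>k\<close>, and left points for smaller shifts. Each time the shift is confined both by
      \<open>m\<close> and by \<open>gap h j\<close>.\<close>
    consider "b - 1 - k \<le> k + 1 - a" | "k + 1 - a \<le> b - 1 - k" "k - m < int h * int s"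
      | "k + 1 - a \<le> b - 1 - k" "int h * int s \<le> k - m" by linarith
    then show ?thesis
    proof cases
      case 1
      then have "right_indices b k s \<subseteq> {j \<in> J. In A1 j s}"
        using RJ s by (auto simp: right_indices_def In_def A1_def m_def)
      then have "card (right_indices b k s) \<le> card {j \<in> J. In A1 j s}"
        using finJ by (intro card_mono) auto
      then show ?thesis by linarith
    next
      case 2
      then have "right_indices b k s \<subseteq> {j \<in> J. In A2 j s}"
        using RJ s by (auto simp: right_indices_def In_def A2_def m_def)
      then have "card (right_indices b k s) \<le> card {j \<in> J. In A2 j s}"
        using finJ by (intro card_mono) auto
      then show ?thesis by linarith
    next
      case 3
      then have "left_indices a k s \<subseteq> {j \<in> J. In A3 j s}"
        using LJ s by (auto simp: left_indices_def In_def A3_def m_def)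
      then have "card (left_indices a k s) \<le> card {j \<in> J. In A3 j s}"
        using finJ by (intro card_mono) auto
      then show ?thesis by linarith
    qed
  qed auto
  \<comment> \<open>After exchanging the sums, each index counts the multiples of \<open>h\<close>
    in a single window.\<close>
  have each: "int h * int (\<Sum>s<N. card {j \<in> J. In A j s}) \<le> (\<Sum>j\<in>J. min m (gap h j) + int h)" for A
  proof -
    have "int h * int (\<Sum>s<N. card {j \<in> J. In A j s}) = (\<Sum>j\<in>J. int h * int (card {s. s < N \<and> In A j s}))"
      by (simp add: sum_card_swap[OF finJ] sum_distrib_left)
    also have "\<dots> \<le> (\<Sum>j\<in>J. min m (gap h j) + int h)"
    proof (rule sum_mono)
      fix j
      have "0 \<le> min m (gap h j)" using m gap_ge[of h j] by auto
      then show "int h * int (card {s. s < N \<and> In A j s}) \<le> min m (gap h j) + int h"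
        unfolding In_def by (rule card_multiples_le[OF h])
    qed
    finally show ?thesis .
  qed
  have "int (\<Sum>s<N. min (card (left_indices a k s)) (card (right_indices b k s)))
      \<le> int (\<Sum>s<N. card {j \<in> J. In A1 j s} + card {j \<in> J. In A2 j s} + card {j \<in> J. In A3 j s})"
    unfolding of_nat_le_iff by (rule sum_mono) (rule pointwise)
  then have "int h * int (\<Sum>s<N. min (card (left_indices a k s)) (card (right_indices b k s)))
      \<le> int h * int (\<Sum>s<N. card {j \<in> J. In A1 j s} + card {j \<in> J. In A2 j s} + card {j \<in> J. In A3 j s})"
    by (intro mult_left_mono) auto
  also have "\<dots> = int h * int (\<Sum>s<N. card {j \<in> J. In A1 j s}) + int h * int (\<Sum>s<N. card {j \<in> J. In A2 j s})
      + int h * int (\<Sum>s<N. card {j \<in> J. In A3 j s})"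
    by (simp only: sum.distrib of_nat_add distrib_left)
  also have "\<dots> \<le> 3 * (\<Sum>j\<in>J. min m (gap h j) + int h)"
    using each[of A1] each[of A2] each[of A3] by linarith
  finally show ?thesis .
qed

text \<open>Dividing all widths by \<open>h\<close> reduces the claim to
  \<open>sum_min_powers_le\<close>. The \<open>90\<close> collects 3 windows, 3 for passing from
  gaps to powers of two, 5 from that lemma and 2 from the charging.\<close>

lemma card_left_right_pairs_wide:
  assumes "int h \<le> m" "m = min (k + 1 - a) (b - 1 - k)"
  shows "real (card (left_right_pairs (strip a b) k))
    \<le> 90 * (m / h) * log 2 (real_of_int (b - a) / m) + h"
proof -
  define M where "M = m / h"
  define W where "W = real_of_int (b - a) / h"
  have ab: "a \<le> k" "k + 1 < b" "2 * m \<le> b - a" using assms h by linarith+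
  have hp: "0 < real h" using h by simp
  have M: "1 \<le> M" using assms(1) hp by (simp add: M_def field_simps)
  have W: "2 * M \<le> W"
    using hp of_int_le_iff[of "2 * m" "b - a", where 'a = real] ab(3)
    by (simp add: M_def W_def divide_simps)
  let ?J = "{j. j < h \<and> int h * 2 ^ j < 2 * (b - a)}"
  let ?S = "\<Sum>s<N. min (card (left_indices a k s)) (card (right_indices b k s))"
  have J: "?J = {j. j < h \<and> 2 ^ j < 2 * W}"
  proof -
    have "int h * 2 ^ j < 2 * (b - a) \<longleftrightarrow> 2 ^ j < 2 * W" for j
    proof -
      have "int h * 2 ^ j < 2 * (b - a) \<longleftrightarrow> real_of_int (int h * 2 ^ j) < real_of_int (2 * (b - a))"
        by (simp only: of_int_less_iff)
      also have "\<dots> \<longleftrightarrow> 2 ^ j < 2 * W" using hp by (simp add: W_def field_simps)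
      finally show ?thesis .
    qed
    then show ?thesis by simp
  qed
  have "real h * real ?S = real_of_int (int h * int ?S)" by simp
  also have "\<dots> \<le> real_of_int (3 * (\<Sum>j\<in>?J. min m (gap h j) + int h))"
    unfolding of_int_le_iff assms(2) by (rule sum_min_indices_le[OF ab(1,2)])
  also have "\<dots> = 3 * (\<Sum>j\<in>?J. real_of_int (min m (gap h j) + int h))" by simp
  also have "\<dots> \<le> 3 * (\<Sum>j\<in>?J. 3 * real h * min M (2 ^ j))"
  proof (intro mult_left_mono sum_mono)
    fix j assume "j \<in> ?J"
    then have "gap h j \<le> int h * 2 ^ j + int h" by (simp add: gap_def)
    also have "\<dots> \<le> 2 * (int h * 2 ^ j)" using mult_left_mono[of 1 "2 ^ j :: int" "int h"] by simp
    finally have "min m (gap h j) + int h \<le> min m (2 * (int h * 2 ^ j)) + int h" by linarith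
    then have "real_of_int (min m (gap h j) + int h) \<le> real_of_int (min m (2 * (int h * 2 ^ j)) + int h)"
      by (simp only: of_int_le_iff)
    also have "\<dots> = min (real h * M) (2 * (real h * 2 ^ j)) + real h"
      using hp by (simp add: M_def of_int_min)
    \<comment> \<open>Both \<open>M\<close> and \<open>2 ^ j\<close> are at least one, so the
      additive \<open>h\<close> is at most one further copy of the minimum.\<close>
    also have "\<dots> \<le> 3 * min (real h * M) (real h * 2 ^ j)"
    proof -
      have "real h \<le> real h * M" using mult_left_mono[OF M, of "real h"] by simp
      moreover have "real h \<le> real h * 2 ^ j" using mult_left_mono[of 1 "2 ^ j" "real h"] by simp
      moreover have "min x (2 * y) + z \<le> 3 * min x y" if "z \<le> x" "z \<le> y" "0 \<le> z" for x y z :: real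
        using that by (simp add: min_def)
      ultimately show ?thesis using hp by simp
    qed
    also have "min (real h * M) (real h * 2 ^ j) = real h * min M (2 ^ j)"
      using hp by (simp add: min_mult_distrib_left)
    finally show "real_of_int (min m (gap h j) + int h) \<le> 3 * real h * min M (2 ^ j)" by simp
  qed simp
  also have "\<dots> = 9 * real h * (\<Sum>j | j < h \<and> 2 ^ j < 2 * W. min M (2 ^ j))"
    unfolding J by (simp add: sum_distrib_left mult.assoc)
  also have "\<dots> \<le> 9 * real h * (5 * M * log 2 (W / M))"
    by (intro mult_left_mono sum_min_powers_le M W) simp
  finally have "real h * real ?S \<le> real h * (45 * M * log 2 (W / M))" by simp
  then have S: "real ?S \<le> 45 * M * log 2 (W / M)" using hp by (simp only: mult_le_cancel_left_pos)
  have WM: "W / M = real_of_int (b - a) / m" using hp by (simp add: W_def M_def)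
  have "real (card (left_right_pairs (strip a b) k)) \<le> real (2 * ?S + h)"
    using card_left_right_pairs_le_sum[of a b k] by (simp only: of_nat_le_iff)
  also have "\<dots> = 2 * real ?S + real h" by simp
  also have "\<dots> \<le> 2 * (45 * M * log 2 (W / M)) + real h" using S by linarith
  finally have "real (card (left_right_pairs (strip a b) k)) \<le> 90 * M * log 2 (W / M) + real h"
    by simp
  then show ?thesis unfolding WM by (simp add: M_def)
qed

end

section \<open>Potentials of partitions into strips\<close>

text \<open>The line encoded by \<open>l\<close> runs between the keys \<open>l\<close> and
  \<open>l + 1\<close>, hence the comparison \<open>x \<le> l\<close>. An unprocessed line
  \<open>k\<close> therefore cuts the cell of the key \<open>k\<close>.\<close>

definition cell :: "int set \<Rightarrow> int set \<Rightarrow> int \<Rightarrow> int set" where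
  "cell D E x = {y \<in> D. \<forall>l\<in>E. x \<le> l \<longleftrightarrow> y \<le> l}"

text \<open>A strip of \<open>w\<close> keys contributes \<open>w \<phi>(w)\<close> in total.\<close>

definition potential :: "(nat \<Rightarrow> real) \<Rightarrow> int set \<Rightarrow> int set \<Rightarrow> real" where
  "potential \<phi> D E = (\<Sum>x\<in>D. \<phi> (card (cell D E x)))"

lemma cell_insert_left: "x \<in> cell D E k \<Longrightarrow> x \<le> k \<Longrightarrow> cell D (insert k E) x = {y \<in> cell D E k. y \<le> k}"
  by (auto simp: cell_def)

lemma cell_insert_right: "x \<in> cell D E k \<Longrightarrow> k < x \<Longrightarrow> cell D (insert k E) x = {y \<in> cell D E k. k < y}"
  by (auto simp: cell_def)

lemma cell_insert_other:
  assumes "x \<in> D - cell D E k"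
  shows "cell D (insert k E) x = cell D E x"
proof -
  obtain l where l: "l \<in> E" "(k \<le> l) \<noteq> (x \<le> l)" using assms by (auto simp: cell_def)
  have "x \<le> k \<longleftrightarrow> y \<le> k" if "\<forall>l\<in>E. x \<le> l \<longleftrightarrow> y \<le> l" for y
    using that l by force
  then show ?thesis by (auto simp: cell_def)
qed

text \<open>Only keys of the strip cut by \<open>k\<close> change their cell, so all other summands
  cancel.\<close>

lemma potential_insert:
  fixes D E :: "int set" and k :: int and \<phi> :: "nat \<Rightarrow> real"
  assumes "finite D"
  defines "C \<equiv> cell D E k"
  defines "L \<equiv> {y \<in> C. y \<le> k}" and "R \<equiv> {y \<in> C. k < y}"
  shows "potential \<phi> D E - potential \<phi> D (insert k E)
    = card C * \<phi> (card C) - card L * \<phi> (card L) - card R * \<phi> (card R)"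
proof -
  have C: "C \<subseteq> D" "finite C" using assms(1) by (auto simp: C_def cell_def)
  have split: "sum g D = sum g C + sum g (D - C)" for g :: "int \<Rightarrow> real"
    using C assms(1) by (metis add.commute sum.subset_diff)
  have "sum g C = sum g L + sum g R" for g :: "int \<Rightarrow> real"
  proof -
    have "C = L \<union> R" "L \<inter> R = {}" by (auto simp: L_def R_def)
    then show ?thesis using C by (metis finite_Un sum.union_disjoint)
  qed
  moreover have "cell D (insert k E) x = L" if "x \<in> L" for x
    using that cell_insert_left[of x D E k] by (simp add: L_def C_def)
  moreover have "cell D (insert k E) x = R" if "x \<in> R" for x
    using that cell_insert_right[of x D E k] by (simp add: R_def C_def)
  moreover have "cell D (insert k E) x = cell D E x" if "x \<in> D - C" for x
    using that cell_insert_other by (simp add: C_def)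
  moreover have "cell D E x = C" if "x \<in> C" for x
    using that by (auto simp: C_def cell_def)
  ultimately show ?thesis
    unfolding potential_def split by simp
qed

lemma convex_int_set_eq:
  fixes C :: "int set"
  assumes "finite C" "k \<in> C" and convex: "\<And>x y z. x \<in> C \<Longrightarrow> z \<in> C \<Longrightarrow> x \<le> y \<Longrightarrow> y \<le> z \<Longrightarrow> y \<in> C"
  obtains a b where "C = {a..<b}" "a \<le> k" "k < b"
proof
  have ne: "C \<noteq> {}" using assms(2) by auto
  show "C = {Min C..<Max C + 1}"
    using assms(1) convex[OF Min_in[OF assms(1) ne] Max_in[OF assms(1) ne]] by auto
  show "Min C \<le> k" "k < Max C + 1" using assms(1,2) by (auto simp: less_Suc_eq_le)
qed

text \<open>Amortisation: each cut costs at most \<open>K\<close> plus the drop in the sum of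
  \<open>F\<close> over the widths of the current strips. The drops telescope, and the final sum is
  nonnegative.\<close>

lemma WB_sigma_le_potential:
  fixes F :: "nat \<Rightarrow> real"
  assumes X: "finite X" and \<sigma>: "distinct \<sigma>" "set \<sigma> \<subseteq> lines X"
    and F: "\<And>w. 0 \<le> F w"
    and cost: "\<And>a b k. a \<le> k \<Longrightarrow> k + 1 < b \<Longrightarrow>
      real (crossings {p \<in> X. a \<le> fst p \<and> fst p < b} k)
        \<le> K + F (nat (b - a)) - F (nat (k + 1 - a)) - F (nat (b - 1 - k))"
  shows "real (WB_sigma X \<sigma>) \<le> K * real (length \<sigma>) + F (card {Min (fst ` X)..Max (fst ` X)})"
proof -
  define D where "D = {Min (fst ` X)..Max (fst ` X)}"
  \<comment> \<open>Spreads \<open>F w\<close> evenly over the \<open>w\<close> keys of a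
    strip.\<close>
  define \<phi> where "\<phi> w = F w / real w" for w
  define \<Phi> where "\<Phi> i = potential \<phi> D (set (take i \<sigma>))" for i
  have D: "finite D" "\<And>p. p \<in> X \<Longrightarrow> fst p \<in> D" using X by (auto simp: D_def)
  have step: "real (crossings (strip_points X (set (take i \<sigma>)) (\<sigma> ! i)) (\<sigma> ! i)) \<le> K + (\<Phi> i - \<Phi> (Suc i))"
    if i: "i < length \<sigma>" for i
  proof -
    define k where "k = \<sigma> ! i"
    define E where "E = set (take i \<sigma>)"
    have kE: "k \<notin> E"
      using \<sigma>(1) i unfolding k_def E_def by (auto simp: in_set_conv_nth nth_eq_iff_index_eq)
    have Suc: "set (take (Suc i) \<sigma>) = insert k E"
      using i by (simp add: take_Suc_conv_app_nth k_def E_def)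
    have "k \<in> lines X" using \<sigma>(2) i by (auto simp: k_def)
    then have kD: "k \<in> D" "k + 1 \<in> D" by (auto simp: lines_def D_def)
    let ?C = "cell D E k"
    \<comment> \<open>Only the line \<open>k\<close> separates \<open>k\<close> from
      \<open>k + 1\<close>, and it is new. So both sides of the cut are nonempty, as
      \<open>cost\<close> requires.\<close>
    have k1: "k + 1 \<in> ?C"
    proof -
      have "k \<le> l \<longleftrightarrow> k + 1 \<le> l" if "l \<in> E" for l
        using that kE by (cases "k = l") auto
      then show ?thesis using kD by (auto simp: cell_def)
    qed
    obtain a b where C: "?C = {a..<b}" "a \<le> k" "k < b"
    proof (rule convex_int_set_eq)
      show "finite ?C" using D(1) by (simp add: cell_def)
      show "k \<in> ?C" using kD by (simp add: cell_def)
      show "y \<in> ?C" if "x \<in> ?C" "z \<in> ?C" "x \<le> y" "y \<le> z" for x y z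
        using that by (fastforce simp: cell_def D_def)
    qed
    have "k + 1 < b" using k1 C by auto
    have LR: "{y \<in> ?C. y \<le> k} = {a..<k+1}" "{y \<in> ?C. k < y} = {k+1..<b}"
      unfolding C(1) using C(2) \<open>k + 1 < b\<close> by auto
    have "strip_points X E k = {p \<in> X. fst p \<in> ?C}"
    proof -
      have "((l < k \<longrightarrow> l < x) \<and> (k < l \<longrightarrow> x \<le> l)) \<longleftrightarrow> (k \<le> l \<longleftrightarrow> x \<le> l)" if "l \<in> E" for l x
        using that kE by (cases "k = l") auto
      then show ?thesis using D(2) by (auto simp: strip_points_def cell_def)
    qed
    then have "strip_points X E k = {p \<in> X. a \<le> fst p \<and> fst p < b}" by (simp add: C(1))
    then have bound: "real (crossings (strip_points X E k) k)
        \<le> K + F (nat (b - a)) - F (nat (k + 1 - a)) - F (nat (b - 1 - k))"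
      using cost[OF C(2) \<open>k + 1 < b\<close>] by simp
    have "F (nat (b - a)) - F (nat (k + 1 - a)) - F (nat (b - 1 - k)) = \<Phi> i - \<Phi> (Suc i)"
    proof -
      have "\<Phi> i - \<Phi> (Suc i) = real (card {a..<b}) * \<phi> (card {a..<b})
          - real (card {a..<k+1}) * \<phi> (card {a..<k+1}) - real (card {k+1..<b}) * \<phi> (card {k+1..<b})"
        using potential_insert[OF D(1), of \<phi> E k, unfolded LR, unfolded C(1)]
        by (simp only: \<Phi>_def Suc E_def[symmetric])
      also have "\<dots> = F (nat (b - a)) - F (nat (k + 1 - a)) - F (nat (b - 1 - k))"
      proof -
        have *: "real (card {x..<y}) * \<phi> (card {x..<y}) = F (nat (y - x))" if "x < y" for x y :: int
          using that by (simp add: \<phi>_def)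
        have "a < b" "a < k + 1" "b - 1 - k = b - (k + 1)" using C(2) \<open>k + 1 < b\<close> by auto
        then show ?thesis using *[of a b] *[of a "k + 1"] *[of "k + 1" b] \<open>k + 1 < b\<close> by (simp only:)
      qed
      finally show ?thesis by simp
    qed
    then show ?thesis using bound unfolding k_def E_def by linarith
  qed
  have "real (WB_sigma X \<sigma>) \<le> (\<Sum>i<length \<sigma>. K + (\<Phi> i - \<Phi> (Suc i)))"
    unfolding WB_sigma_def of_nat_sum by (rule sum_mono) (simp add: step)
  also have "\<dots> = K * real (length \<sigma>) + (\<Phi> 0 - \<Phi> (length \<sigma>))"
    by (simp add: sum.distrib sum_lessThan_telescope')
  also have "0 \<le> \<Phi> (length \<sigma>)"
    unfolding \<Phi>_def potential_def \<phi>_def by (intro sum_nonneg divide_nonneg_nonneg F) auto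
  then have "K * real (length \<sigma>) + (\<Phi> 0 - \<Phi> (length \<sigma>)) \<le> K * real (length \<sigma>) + \<Phi> 0" by simp
  also have "\<Phi> 0 \<le> F (card D)"
  proof -
    have "\<Phi> 0 = real (card D) * \<phi> (card D)" by (simp add: \<Phi>_def potential_def cell_def)
    then show ?thesis using F by (cases "card D = 0") (auto simp: \<phi>_def)
  qed
  finally show ?thesis by (simp add: D_def)
qed

section \<open>The separation\<close>

text \<open>The upper bound in the first claim is \<open>u + v\<close> times the binary entropy of
  the split. It is a sum of one nonnegative term per part, of which the one for the smaller part is
  kept.\<close>

lemma entropy_split_ge:
  fixes u v :: real
  assumes "0 < u" "0 < v"
  shows "min u v * log 2 ((u + v) / min u v) \<le> (u + v) * log 2 (u + v) - u * log 2 u - v * log 2 v"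
    and "0 \<le> min u v * log 2 ((u + v) / min u v)"
proof -
  have nonneg: "0 \<le> log 2 (u + v) - log 2 x" if "0 < x" "x \<le> u + v" for x
    using that by simp
  have "(u + v) * log 2 (u + v) - u * log 2 u - v * log 2 v
      = u * (log 2 (u + v) - log 2 u) + v * (log 2 (u + v) - log 2 v)"
    by (simp add: algebra_simps)
  moreover have "0 \<le> u * (log 2 (u + v) - log 2 u)" "0 \<le> v * (log 2 (u + v) - log 2 v)"
    using assms nonneg[of u] nonneg[of v] by (auto intro!: mult_nonneg_nonneg)
  moreover have "log 2 ((u + v) / min u v) = log 2 (u + v) - log 2 (min u v)"
    using assms by (simp add: log_divide min_def)
  ultimately show "min u v * log 2 ((u + v) / min u v) \<le> (u + v) * log 2 (u + v) - u * log 2 u - v * log 2 v"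
    "0 \<le> min u v * log 2 ((u + v) / min u v)"
    by (auto simp: min_def)
qed

lemma mult_log_le:
  assumes "d \<le> n" "log 2 (real n) \<le> c" "0 \<le> c"
  shows "real d * log 2 (real d) \<le> real n * c"
proof (cases "d = 0")
  case False
  then have "log 2 (real d) \<le> log 2 (real n)" using assms(1) by simp
  then have "log 2 (real d) \<le> c" using assms(2) by linarith
  then show ?thesis using assms(1) False by (intro mult_mono) auto
qed (use assms in simp)

text \<open>The surplus pays \<open>min m h\<close> for a cut of a strip of more than \<open>h\<close> keys with narrower side \<open>m\<close>.\<close>

definition surplus :: "nat \<Rightarrow> nat \<Rightarrow> real" where
  "surplus h w = (if h < w then 2 * real w - real h else 0)"

text \<open>An entropy part and a surplus part, both doubled because crossings are up to twice as
  many as left-to-right pairs, plus one: \<open>180\<close> is twice the \<open>90\<close> of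
  \<open>card_left_right_pairs_wide\<close>.\<close>

definition weight :: "nat \<Rightarrow> nat \<Rightarrow> real" where
  "weight h w = 180 / real h * (real w * log 2 (real w)) + 2 * surplus h w"

lemma weight_nonneg: "0 \<le> weight h w"
proof -
  have "0 \<le> real w * log 2 (real w)" by (cases "w = 0") auto
  then show ?thesis by (auto simp: weight_def surplus_def)
qed

lemma weight_split_ge:
  assumes "0 < h" "0 < u" "0 < v"
  defines "m \<equiv> min u v"
  shows "180 / real h * (real m * log 2 (real (u + v) / real m)) + (if h < u + v then 2 * real (min m h) else 0)
    \<le> weight h (u + v) - weight h u - weight h v"
proof -
  let ?e = "real (u + v) * log 2 (real (u + v)) - real u * log 2 (real u) - real v * log 2 (real v)"
  have "180 / real h * (real m * log 2 (real (u + v) / real m)) \<le> 180 / real h * ?e"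
    using entropy_split_ge(1)[of u v] assms by (intro mult_left_mono) (auto simp: m_def of_nat_min)
  \<comment> \<open>When \<open>h < u + v\<close>, the surplus drops by \<open>h\<close> if both
    parts exceed \<open>h\<close>, by twice the narrower part if one does, and by more than
    \<open>u + v\<close> if none does.\<close>
  moreover have "(if h < u + v then 2 * real (min m h) else 0)
      \<le> 2 * (surplus h (u + v) - surplus h u - surplus h v)"
    by (auto simp: surplus_def m_def min_def)
  moreover have "weight h (u + v) - weight h u - weight h v
    = 180 / real h * ?e + 2 * (surplus h (u + v) - surplus h u - surplus h v)"
    by (simp add: weight_def algebra_simps)
  ultimately show ?thesis by linarith
qed

section \<open>The upper bound on \<open>WB\<close>\<close>

context blocks
begin

text \<open>Three regimes: at most \<open>h\<close> keys give at most one pair, a side of at most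
  \<open>h\<close> keys is paid by the surplus, and otherwise entropy and surplus pay together. The
  \<open>3\<close> is two crossings for a single pair and one from alternation.\<close>

lemma crossings_strip_le:
  assumes "a \<le> k" "k + 1 < b"
  shows "real (crossings (strip a b) k)
    \<le> 3 + weight h (nat (b - a)) - weight h (nat (k + 1 - a)) - weight h (nat (b - 1 - k))"
proof -
  define u where "u = nat (k + 1 - a)"
  define v where "v = nat (b - 1 - k)"
  define m where "m = min u v"
  have uv: "0 < u" "0 < v" "nat (b - a) = u + v" "b - a = int (u + v)"
    "int u = k + 1 - a" "int v = b - 1 - k" "int m = min (k + 1 - a) (b - 1 - k)"
    using assms by (auto simp: u_def v_def m_def)
  let ?P = "left_right_pairs (strip a b) k"
  have "crossings (strip a b) k \<le> 2 * card ?P + 1"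
    by (rule crossings_le_left_right_pairs[OF strip_finite strip_semi])
  then have c: "real (crossings (strip a b) k) \<le> 2 * real (card ?P) + 1" by linarith
  let ?H = "180 / real h * (real m * log 2 (real (u + v) / real m))"
  have w: "?H + (if h < u + v then 2 * real (min m h) else 0) \<le> weight h (u + v) - weight h u - weight h v"
    unfolding m_def by (rule weight_split_ge[OF h uv(1,2)])
  have "0 \<le> real m * log 2 (real (u + v) / real m)"
    unfolding m_def of_nat_min of_nat_add by (rule entropy_split_ge(2)) (use uv(1,2) in simp_all)
  then have H: "0 \<le> ?H" by (rule mult_nonneg_nonneg[rotated]) simp
  have "2 * real (card ?P) + 1 \<le> 3 + (?H + (if h < u + v then 2 * real (min m h) else 0))"
  proof -
    consider "u + v \<le> h" | "h < u + v" "m \<le> h" | "h < u + v" "h \<le> m" by linarith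
    then show ?thesis
    proof cases
      case 1
      then have "card ?P \<le> 1" using uv(4) by (intro card_left_right_pairs_narrow) linarith
      then have "real (card ?P) \<le> 1" by simp
      then show ?thesis using H 1 by (simp only: not_less[symmetric] if_False)
    next
      case 2
      have "int (card ?P) \<le> int m" unfolding uv(7) by (rule card_left_right_pairs_le_width[OF assms])
      then have "real (card ?P) \<le> real (min m h)" using 2 by simp
      then have "2 * real (card ?P) + 1 \<le> 3 + (?H + 2 * real (min m h))" using H by linarith
      then show ?thesis using 2(1) by simp
    next
      case 3
      have "real (card ?P)
          \<le> 90 * (real_of_int (int m) / real h) * log 2 (real_of_int (b - a) / real_of_int (int m)) + real h"
        using 3(2) by (intro card_left_right_pairs_wide uv(7)) simp
      then have "real (card ?P) \<le> 90 * (real m / real h) * log 2 (real (u + v) / real m) + real h"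
        unfolding uv(4) by simp
      also have "90 * (real m / real h) * log 2 (real (u + v) / real m) = ?H / 2" by simp
      finally have "2 * real (card ?P) + 1 \<le> 3 + (?H + 2 * real (min m h))" using 3(2) by simp
      then show ?thesis using 3(1) by simp
    qed
  qed
  then show ?thesis using c w unfolding uv(3) u_def[symmetric] v_def[symmetric] by linarith
qed

text \<open>Choosing \<open>N = 2 ^ h\<close> makes block shifts and largest gaps comparable, so the
  keys span only \<open>O(n)\<close> integers.\<close>

lemma fst_bounds:
  assumes "p \<in> X" "N = 2 ^ h"
  shows "0 \<le> fst p" "fst p < 2 * int (N * h)"
proof -
  let ?s = "block h p" and ?j = "index h p"
  have e: "fst p = int h * (int ?s + 2 ^ ?j) + int ?j"
    using fst_eq_column[OF assms(1)] by (simp add: column_def)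
  then show "0 \<le> fst p" by simp
  have "(2::int) ^ ?j \<le> 2 ^ h" using point_eq(2)[OF assms(1)] by (intro power_increasing) auto
  moreover have "(2::int) ^ h = int N" using assms(2) by simp
  ultimately have "int ?s + 2 ^ ?j \<le> 2 * int N - 1" using point_eq(1)[OF assms(1)] by linarith
  then have "int h * (int ?s + 2 ^ ?j) \<le> int h * (2 * int N - 1)" by (intro mult_left_mono) auto
  also have "\<dots> = 2 * int (N * h) - int h" by (simp add: algebra_simps)
  finally show "fst p < 2 * int (N * h)" using e point_eq(2)[OF assms(1)] by linarith
qed

text \<open>The key range has at most \<open>2 * n\<close> integers for \<open>n = N * h\<close>,
  and \<open>log 2 (2 * n) \<le> 3 * h\<close>. The constant is \<open>6\<close> for the cuts at
  cost \<open>3\<close> each, \<open>180 * 2 * 3 = 1080\<close> for the entropy and \<open>8\<close>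
  for the surplus.\<close>

lemma WB_le:
  assumes "h = 2 ^ i" "N = 2 ^ h"
  shows "real (WB X) \<le> 1094 * real (N * h)"
proof -
  let ?D = "{Min (fst ` X)..Max (fst ` X)}"
  have "0 < N * h" using assms h by simp
  then have "X \<noteq> {}" using card_X by fastforce
  then have "Min (fst ` X) \<in> fst ` X" "Max (fst ` X) \<in> fst ` X" using finite_X by simp_all
  then have "0 \<le> Min (fst ` X)" "Max (fst ` X) < 2 * int (N * h)"
    using fst_bounds[OF _ assms(2)] by auto
  then have "?D \<subseteq> {0..<2 * int (N * h)}" by (intro subsetI) (simp only: atLeastAtMost_iff atLeastLessThan_iff, linarith)
  then have "card ?D \<le> card {0..<2 * int (N * h)}" by (intro card_mono) auto
  also have "\<dots> = 2 * (N * h)" by (simp add: nat_mult_distrib)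
  finally have D: "card ?D \<le> 2 * (N * h)" .
  have lin: "lines X \<subseteq> ?D" by (auto simp: lines_def)
  have finl: "finite (lines X)" by (rule finite_subset[OF lin]) simp
  have cl: "card (lines X) \<le> 2 * (N * h)" using card_mono[OF _ lin] D by simp
  have "real (WB_sigma X \<sigma>) \<le> 1094 * real (N * h)" if \<sigma>: "\<sigma> \<in> orderings X" for \<sigma>
  proof -
    have "distinct \<sigma>" "set \<sigma> = lines X" using \<sigma> by (auto simp: orderings_def)
    then have "length \<sigma> \<le> 2 * (N * h)" using cl distinct_card[of \<sigma>] by simp
    then have len: "real (length \<sigma>) \<le> 2 * real (N * h)" by linarith
    have "real (WB_sigma X \<sigma>) \<le> 3 * real (length \<sigma>) + weight h (card ?D)"
    proof (rule WB_sigma_le_potential)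
      show "real (crossings {p \<in> X. a \<le> fst p \<and> fst p < b} k)
          \<le> 3 + weight h (nat (b - a)) - weight h (nat (k + 1 - a)) - weight h (nat (b - 1 - k))"
        if "a \<le> k" "k + 1 < b" for a b k
        using crossings_strip_le[OF that] by (simp add: strip_def)
    qed (use \<open>distinct \<sigma>\<close> \<open>set \<sigma> = lines X\<close> finite_X weight_nonneg in auto)
    also have "weight h (card ?D) \<le> 1088 * real (N * h)"
    proof -
      have "log 2 (real (2 * (N * h))) = 1 + real h + real i"
        using assms by (simp add: log_mult log_nat_power)
      moreover have "i < h" using assms by simp
      ultimately have "log 2 (real (2 * (N * h))) \<le> 3 * real h" using h by linarith
      then have "real (card ?D) * log 2 (real (card ?D)) \<le> real (2 * (N * h)) * (3 * real h)"
        by (intro mult_log_le D) auto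
      then have "180 / real h * (real (card ?D) * log 2 (real (card ?D))) \<le> 180 / real h * (real (2 * (N * h)) * (3 * real h))"
        by (intro mult_left_mono) auto
      also have "\<dots> = 1080 * real (N * h)" using h by simp
      finally have "180 / real h * (real (card ?D) * log 2 (real (card ?D))) \<le> 1080 * real (N * h)" .
      moreover have "2 * surplus h (card ?D) \<le> 8 * real (N * h)"
      proof -
        have "real (card ?D) \<le> 2 * real (N * h)" using D by linarith
        moreover have "surplus h (card ?D) \<le> 2 * real (card ?D)" by (simp add: surplus_def)
        ultimately show ?thesis by linarith
      qed
      ultimately show ?thesis unfolding weight_def by linarith
    qed
    finally show ?thesis using len by linarith
  qed
  moreover have "WB X \<in> WB_sigma X ` orderings X"
    unfolding WB_def
  proof (rule Max_in)
    have "orderings X \<subseteq> {xs. set xs \<subseteq> lines X \<and> length xs = card (lines X)}"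
      using distinct_card by (fastforce simp: orderings_def)
    then show "finite (WB_sigma X ` orderings X)"
      using finite_lists_length_eq[OF finl] finite_subset by blast
    show "WB_sigma X ` orderings X \<noteq> {}"
      using finite_distinct_list[OF finl] by (auto simp: orderings_def)
  qed
  ultimately show ?thesis by auto
qed

end

theorem theorem1p1:
  "\<exists>c1 c2 :: real. c1 > 0 \<and> c2 > 0 \<and>
     (\<forall>n' :: int. \<exists>n :: nat. int n \<ge> n' \<and>
        (\<exists>X :: point set. finite X \<and> card X = n \<and> permutation X \<and>
           real (opt X) \<ge> c1 * real n * log 2 (log 2 (real n)) \<and>
           real (WB X) \<le> c2 * real n * log 2 (log 2 (log 2 (real n)))))"
proof -
  have main: "\<exists>n. int n \<ge> n' \<and>
        (\<exists>X :: point set. finite X \<and> card X = n \<and> permutation X \<and>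
           real (opt X) \<ge> 1/4 * real n * log 2 (log 2 (real n)) \<and>
           real (WB X) \<le> 1094 * real n * log 2 (log 2 (log 2 (real n))))" for n'
  proof -
    \<comment> \<open>The lower bound \<open>2\<close> makes the triple logarithm of
      \<open>n\<close> at least one, and \<open>nat n'\<close> makes \<open>n\<close> large
      enough.\<close>
    define i where "i = max 2 (nat n')"
    define h where "h = (2::nat) ^ i"
    define N where "N = (2::nat) ^ h"
    interpret blocks h N "bit_reversal i"
      by unfold_locales (simp_all add: h_def bit_reversal_bij)
    let ?n = "N * h"
    have i: "2 \<le> i" "n' \<le> int i" by (auto simp: i_def)
    have ih: "i < h" by (simp add: h_def)
    have "1 \<le> N" by (simp add: N_def)
    then have "h \<le> ?n" by simp
    then have "n' \<le> int ?n" using i ih by linarith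
    have logn: "log 2 (real ?n) = real h + real i"
      by (simp add: N_def h_def log_mult log_nat_power)
    have "log 2 (real h + real i) \<le> log 2 (2 * real h)" using ih by simp
    also have "\<dots> = real i + 1" by (simp add: h_def log_mult log_nat_power)
    finally have upper: "log 2 (log 2 (real ?n)) \<le> real i + 1" by (simp only: logn)
    have "real i = log 2 (real h)" by (simp add: h_def log_nat_power)
    also have "\<dots> \<le> log 2 (real h + real i)" using ih by simp
    finally have lower: "2 \<le> log 2 (log 2 (real ?n))" using i unfolding logn by linarith
    have "log 2 2 \<le> log 2 (log 2 (log 2 (real ?n)))" using lower by (subst log_le_cancel_iff) auto
    then have lll: "1 \<le> log 2 (log 2 (log 2 (real ?n)))" by simp
    \<comment> \<open>The double logarithm is at most \<open>i + 1 \<le> 2 * i\<close>, while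
      \<open>opt X\<close> is at least \<open>n * i / 2\<close>; hence the
      \<open>1/4\<close>.\<close>
    have "1/4 * real ?n * log 2 (log 2 (real ?n)) \<le> 1/4 * real ?n * (2 * real i)"
      using upper i by (intro mult_left_mono) auto
    also have "\<dots> \<le> real (opt X)" using opt_ge[OF h_def refl] by (simp add: mult_ac)
    finally have "1/4 * real ?n * log 2 (log 2 (real ?n)) \<le> real (opt X)" .
    moreover have "real (WB X) \<le> 1094 * real ?n * log 2 (log 2 (log 2 (real ?n)))"
      using WB_le[OF h_def N_def] mult_left_mono[OF lll, of "1094 * real ?n"] by simp
    ultimately show ?thesis using \<open>n' \<le> int ?n\<close> finite_X card_X permutation_X by blast
  qed
  show ?thesis
    by (intro exI[of _ "1/4"] exI[of _ 1094] conjI allI main) simp_all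
qed

end
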